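(* Let $G$ be the Grigorchuk group. Then $G$ is FIG, and in fact $d_I(G)=3$. Thus, residually finite FIG groups need not be virtually solvable.
   Context: The (first) Grigorchuk group is the group $G=\langle a,b,c,d\rangle$ of automorphisms of the infinite rooted binary tree (with vertices the finite words over $\{0,1\}$), where $a$ swaps the two subtrees at the root ($a(0w)=1w$, $a(1w)=0w$) and $b,c,d$ are defined recursively by $b(0w)=0a(w)$, $b(1w)=1c(w)$; $c(0w)=0a(w)$, $c(1w)=1d(w)$; $d(0w)=0w$, $d(1w)=1b(w)$. It is generated by three elements of order 2 (since $d=bc$). Write $s^g=g^{-1}sg$. A group $G$ is invariably generated by a subset $S\subseteq G$ if $G=\langle s^{g(s)}\mid s\in S\rangle$ for every choice of elements $g(s)\in G$, $s\in S$. The group $G$ is FIG if it is invariably generated by some finite subset; for an FIG group $G$, $d_I(G)$ denotes the minimal size of a subset invariably generating $G$. A group is virtually solvable if it has a solvable subgroup of finite index. *)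

theory Defs
  imports "HOL-Algebra.Algebra"
begin

section \<open>Invariable generation\<close>

definition conj_by :: "('a, 'm) monoid_scheme \<Rightarrow> 'a \<Rightarrow> 'a \<Rightarrow> 'a" where
  "conj_by G s g = inv\<^bsub>G\<^esub> g \<otimes>\<^bsub>G\<^esub> s \<otimes>\<^bsub>G\<^esub> g"

definition invariably_generates :: "('a, 'm) monoid_scheme \<Rightarrow> 'a set \<Rightarrow> bool" where
  "invariably_generates G S \<longleftrightarrow>
     S \<subseteq> carrier G \<and>
     (\<forall>g \<in> S \<rightarrow> carrier G. generate G ((\<lambda>s. conj_by G s (g s)) ` S) = carrier G)"

definition FIG :: "('a, 'm) monoid_scheme \<Rightarrow> bool" where
  "FIG G \<longleftrightarrow> (\<exists>S. finite S \<and> invariably_generates G S)"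

text \<open>Only meaningful if \<^term>\<open>FIG G\<close> holds. The finiteness condition is needed because
  \<^term>\<open>card S = 0\<close> for infinite \<^term>\<open>S\<close>.\<close>

definition d_I :: "('a, 'm) monoid_scheme \<Rightarrow> nat" where
  "d_I G = (LEAST n. \<exists>S. finite S \<and> card S = n \<and> invariably_generates G S)"


section \<open>Residual finiteness and virtual solvability\<close>

definition finite_index :: "('a, 'm) monoid_scheme \<Rightarrow> 'a set \<Rightarrow> bool" where
  "finite_index G H \<longleftrightarrow> finite (rcosets\<^bsub>G\<^esub> H)"

definition residually_finite :: "('a, 'm) monoid_scheme \<Rightarrow> bool" where
  "residually_finite G \<longleftrightarrow>
     (\<forall>x \<in> carrier G. x \<noteq> \<one>\<^bsub>G\<^esub> \<longrightarrow> (\<exists>N. N \<lhd> G \<and> finite_index G N \<and> x \<notin> N))"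

definition virtually_solvable :: "('a, 'm) monoid_scheme \<Rightarrow> bool" where
  "virtually_solvable G \<longleftrightarrow>
     (\<exists>H. subgroup H G \<and> finite_index G H \<and> solvable (G\<lparr>carrier := H\<rparr>))"


section \<open>The infinite rooted binary tree and the Grigorchuk group\<close>

text \<open>Vertices are the finite words over \<open>{0,1}\<close>, with \<^term>\<open>False\<close> for \<open>0\<close> and \<^term>\<open>True\<close>
  for \<open>1\<close>; the root is the empty word and the children of \<^term>\<open>u\<close> are the words
  \<^term>\<open>u @ [x]\<close>.\<close>

definition tree_adj :: "bool list \<Rightarrow> bool list \<Rightarrow> bool" where
  "tree_adj u v \<longleftrightarrow> (\<exists>x. v = u @ [x]) \<or> (\<exists>x. u = v @ [x])"

definition tree_auts :: "(bool list \<Rightarrow> bool list) set" where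
  "tree_auts = {f. bij f \<and> f [] = [] \<and> (\<forall>u v. tree_adj (f u) (f v) \<longleftrightarrow> tree_adj u v)}"

text \<open>The product \<open>f \<otimes> g\<close> is the composition \<^term>\<open>f \<circ> g\<close>.\<close>

definition tree_aut_group :: "(bool list \<Rightarrow> bool list) monoid" where
  "tree_aut_group = (BijGroup UNIV)\<lparr>carrier := tree_auts\<rparr>"

fun grig_a :: "bool list \<Rightarrow> bool list" where
  "grig_a [] = []"
| "grig_a (False # w) = True # w"
| "grig_a (True # w) = False # w"

fun grig_b :: "bool list \<Rightarrow> bool list"
and grig_c :: "bool list \<Rightarrow> bool list"
and grig_d :: "bool list \<Rightarrow> bool list" where
  "grig_b [] = []"
| "grig_b (False # w) = False # grig_a w"
| "grig_b (True # w) = True # grig_c w"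
| "grig_c [] = []"
| "grig_c (False # w) = False # grig_a w"
| "grig_c (True # w) = True # grig_d w"
| "grig_d [] = []"
| "grig_d (False # w) = False # w"
| "grig_d (True # w) = True # grig_b w"

definition grigorchuk_group :: "(bool list \<Rightarrow> bool list) monoid" where
  "grigorchuk_group =
     tree_aut_group\<lparr>carrier := generate tree_aut_group {grig_a, grig_b, grig_c, grig_d}\<rparr>"


section \<open>Well-definedness\<close>

lemma mult_tree_aut_group: "f \<otimes>\<^bsub>tree_aut_group\<^esub> g = f \<circ> g" if "f \<in> tree_auts" "g \<in> tree_auts"
  using that by (auto simp: tree_aut_group_def tree_auts_def BijGroup_def Bij_def compose_def)

lemma subgroup_tree_auts: "subgroup tree_auts (BijGroup UNIV)"
proof
  show sub: "tree_auts \<subseteq> carrier (BijGroup UNIV)"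
    by (auto simp: tree_auts_def BijGroup_def Bij_def)
  show "\<one>\<^bsub>BijGroup UNIV\<^esub> \<in> tree_auts"
    by (simp add: tree_auts_def BijGroup_def bij_betw_def)
  show "f \<otimes>\<^bsub>BijGroup UNIV\<^esub> g \<in> tree_auts" if "f \<in> tree_auts" "g \<in> tree_auts" for f g
    using that mult_tree_aut_group[OF that]
    by (auto simp: tree_aut_group_def tree_auts_def intro: bij_comp)
  show "inv\<^bsub>BijGroup UNIV\<^esub> f \<in> tree_auts" if f: "f \<in> tree_auts" for f
  proof -
    have b: "bij f" and f0: "f [] = []"
      and adj: "\<And>u v. tree_adj (f u) (f v) \<longleftrightarrow> tree_adj u v"
      using f by (auto simp: tree_auts_def)
    have "inv\<^bsub>BijGroup UNIV\<^esub> f = inv_into UNIV f"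
      using f sub by (subst inv_BijGroup) (auto simp: BijGroup_def)
    moreover have "f (inv_into UNIV f u) = u" for u
      using b by (simp add: bij_is_surj surj_f_inv_f)
    ultimately show ?thesis
      using b f0 adj[of "inv_into UNIV f _" "inv_into UNIV f _"]
      by (auto simp: tree_auts_def bij_imp_bij_inv inv_f_eq bij_is_inj)
  qed
qed

lemma group_tree_aut_group: "group tree_aut_group"
  unfolding tree_aut_group_def
  by (rule subgroup.subgroup_is_group[OF subgroup_tree_auts group_BijGroup])

lemma involution_in_tree_auts:
  assumes inv: "\<And>w. f (f w) = w" and nil: "f [] = []"
    and child: "\<And>u x. \<exists>y. f (u @ [x]) = f u @ [y]"
  shows "f \<in> tree_auts"
proof -
  have *: "tree_adj (f u) (f v)" if "tree_adj u v" for u v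
    using that child unfolding tree_adj_def by metis
  have "bij f"
    by (rule o_bij[of f]) (auto simp: inv)
  then show ?thesis
    using nil * *[of "f _" "f _"] by (auto simp: tree_auts_def inv)
qed

lemma grig_a_child: "\<exists>y. grig_a (u @ [x]) = grig_a u @ [y]"
  by (cases u rule: grig_a.cases; cases x) auto

lemma grig_bcd_child:
  "\<exists>y. grig_b (u @ [x]) = grig_b u @ [y]"
  "\<exists>y. grig_c (u @ [x]) = grig_c u @ [y]"
  "\<exists>y. grig_d (u @ [x]) = grig_d u @ [y]"
proof (induction u)
  case Nil
  { case 1 show ?case by (cases x) auto next
    case 2 show ?case by (cases x) auto next
    case 3 show ?case by (cases x) auto }
next
  case (Cons z u)
  { case 1 show ?case using Cons.IH grig_a_child[of u x] by (cases z) auto next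
    case 2 show ?case using Cons.IH grig_a_child[of u x] by (cases z) auto next
    case 3 show ?case using Cons.IH by (cases z) auto }
qed

lemma grig_a_involution: "grig_a (grig_a w) = w"
  by (cases w rule: grig_a.cases) auto

lemma grig_bcd_involution:
  "grig_b (grig_b w) = w" "grig_c (grig_c w) = w" "grig_d (grig_d w) = w"
  by (induction w and w and w rule: grig_b_grig_c_grig_d.induct)
     (auto simp: grig_a_involution)

lemma grig_generators_in_tree_auts:
  "grig_a \<in> tree_auts" "grig_b \<in> tree_auts" "grig_c \<in> tree_auts" "grig_d \<in> tree_auts"
  by (rule involution_in_tree_auts; simp add: grig_a_involution grig_bcd_involution
        grig_a_child grig_bcd_child)+

lemma group_grigorchuk_group: "group grigorchuk_group"
proof -
  have "{grig_a, grig_b, grig_c, grig_d} \<subseteq> carrier tree_aut_group"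
    using grig_generators_in_tree_auts by (simp add: tree_aut_group_def)
  then show ?thesis
    unfolding grigorchuk_group_def
    by (intro subgroup.subgroup_is_group group.generate_is_subgroup group_tree_aut_group)
qed

end

theory Submission
  imports Defs
begin

text \<open>
  Write \<open>pr x y\<close> for the automorphism that acts by \<open>x\<close> below \<open>0\<close> and by \<open>y\<close> below \<open>1\<close>; so
  \<open>b = pr a c\<close>, \<open>c = pr a d\<close>, \<open>d = pr 1 b\<close>, while \<open>a\<close> exchanges the two coordinates.

  The set \<open>{a, b, c}\<close> generates invariably. Conjugating everything by one element, let \<open>H\<close>
  contain \<open>a\<close> and conjugates of two of the letters \<open>b, c, d\<close>, say \<open>b\<close> and \<open>c\<close>. The conjugate of
  \<open>b = pr a c\<close> provides conjugates of \<open>a\<close> and of \<open>c\<close> in the group of first sections of elements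
  of \<open>H\<close>, and the conjugate of \<open>c = pr a d\<close> provides one of \<open>d\<close> (the element \<open>a\<close> of \<open>H\<close>
  exchanges the coordinates). Up to conjugacy the sections of \<open>H\<close> thus contain a group of the
  same shape, with the letters \<open>c, d\<close> in place of \<open>b, c\<close>; the next two steps lead to \<open>d, b\<close> and
  back to \<open>b, c\<close>. Measure such a group by the larger of the numbers of letters in the two
  conjugating words. A step does not increase this number, and it decreases it as soon as a letter
  \<open>d\<close> is met at the right place, because the first section of \<open>d\<close> is trivial. A word without loss
  consists of the letters \<open>b\<close>, then \<open>c\<close>, then \<open>d\<close> in consecutive steps, so that the number
  decreases after a few steps (\<open>conj_generate_all\<close>), until \<open>a\<close> and two of \<open>b, c, d\<close> themselves
  are found.

  This shows that some group of iterated sections of \<open>H\<close> is everything, and it remains to go back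
  from the sections to \<open>H\<close>. If the first sections of \<open>H\<close> fill the group \<open>\<Gamma>\<close>, then the elements
  \<open>x\<close> with \<open>pr x 1 \<in> H\<close> form a normal subgroup \<open>R\<close> of \<open>\<Gamma>\<close>, which is nontrivial in the present
  situation. Now every nontrivial normal subgroup of \<open>\<Gamma>\<close> contains a term of a central series with
  factors of exponent 2 (\<open>nontrivial_normal_large\<close>): it contains a copy of the commutator subgroup
  of the branching subgroup \<open>K\<close>, the normal closure of \<open>(ab)\<^sup>2\<close>, below some vertex, and
  the property passes from \<open>N\<close> to the pairs with entries in \<open>N\<close>. Hence \<open>H\<close> contains such a
  subgroup, namely the pairs over \<open>R\<close>. In the nilpotent quotient by that subgroup a proper subgroup
  lies in a proper normal subgroup, which is impossible for \<open>H\<close>, as conjugates of all generators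
  lie in \<open>H\<close>. So \<open>H = \<Gamma>\<close>.

  Two elements never generate \<open>\<Gamma>\<close>, since the parities of the number of swaps on the levels 0, 1, 2
  map \<open>\<Gamma>\<close> onto an elementary abelian group of order 8. The stabilisers of the levels give residual
  finiteness. A solvable subgroup of finite index would contain a nontrivial normal subgroup of
  \<open>\<Gamma>\<close>, hence a nontrivial abelian normal one; but if \<open>f\<close> moves a vertex, then the commutators of
  \<open>f\<close> with the elements of \<open>K\<close> acting below this vertex do not commute with each other.
\<close>

section \<open>Commutators and large normal subgroups\<close>

definition commutator :: "('a, 'b) monoid_scheme \<Rightarrow> 'a \<Rightarrow> 'a \<Rightarrow> 'a" where
  "commutator G x y = x \<otimes>\<^bsub>G\<^esub> y \<otimes>\<^bsub>G\<^esub> inv\<^bsub>G\<^esub> x \<otimes>\<^bsub>G\<^esub> inv\<^bsub>G\<^esub> y"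

context group
begin

lemma inv_mult_cancel [simp]:
  assumes "x \<in> carrier G" "y \<in> carrier G"
  shows "inv x \<otimes> (x \<otimes> y) = y" "x \<otimes> (inv x \<otimes> y) = y"
  using assms by (simp_all flip: m_assoc)

lemma commutator_closed [simp]:
  "x \<in> carrier G \<Longrightarrow> y \<in> carrier G \<Longrightarrow> commutator G x y \<in> carrier G"
  by (simp add: commutator_def)

lemma normal_conj_closed:
  assumes "N \<lhd> G" "n \<in> N" "g \<in> carrier G"
  shows "g \<otimes> n \<otimes> inv g \<in> N" "inv g \<otimes> n \<otimes> g \<in> N"
  using assms by (auto simp: normal.inv_op_closed1 normal.inv_op_closed2)

lemma commutator_in_normal:
  assumes "N \<lhd> G" "n \<in> N" "g \<in> carrier G"
  shows "commutator G n g \<in> N"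
proof -
  interpret N: normal N G by fact
  have "commutator G n g = n \<otimes> (g \<otimes> inv n \<otimes> inv g)"
    using assms N.subset by (auto simp: commutator_def m_assoc)
  then show ?thesis
    using assms normal_conj_closed[OF assms(1) N.m_inv_closed[OF assms(2)]] by simp
qed

end

text \<open>A normal subgroup is large if it contains the last term of a finite central series of \<open>G\<close> with
  factors of exponent 2. The quotient by it is then nilpotent. The exponent makes the property
  inherited by pairs: on an abelian group \<open>A\<close> of exponent 2 the exchange of the coordinates of
  \<open>A \<times> A\<close> acts unipotently.\<close>

inductive large :: "('a, 'b) monoid_scheme \<Rightarrow> 'a set \<Rightarrow> bool" for G where
  large_carrier: "large G (carrier G)"
| large_refine: "large G N \<Longrightarrow> M \<lhd> G \<Longrightarrow> M \<subseteq> N \<Longrightarrow>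
    (\<And>n g. n \<in> N \<Longrightarrow> g \<in> carrier G \<Longrightarrow> commutator G n g \<in> M) \<Longrightarrow>
    (\<And>n. n \<in> N \<Longrightarrow> n \<otimes>\<^bsub>G\<^esub> n \<in> M) \<Longrightarrow> large G M"
| large_mono: "large G N \<Longrightarrow> M \<lhd> G \<Longrightarrow> N \<subseteq> M \<Longrightarrow> large G M"

context group
begin

lemma large_normal: "large G N \<Longrightarrow> N \<lhd> G"
  by (induction rule: large.induct) (simp_all add: normal_self)

text \<open>In a nilpotent group every proper subgroup is contained in a proper normal subgroup. Here this is
  seen along the central series: if \<open>H N = G\<close> and \<open>N\<close> is central modulo \<open>M\<close>, then \<open>H M\<close> is
  normalised by \<open>H\<close> and by \<open>N\<close>, hence normal.\<close>

lemma supplement_of_large: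
  assumes "large G N" "subgroup H G"
    and full: "\<And>M. M \<lhd> G \<Longrightarrow> H \<subseteq> M \<Longrightarrow> M = carrier G"
  shows "H <#> N = carrier G"
  using assms(1)
proof induction
  case large_carrier
  interpret H: subgroup H G by fact
  show ?case
    using H.subset by (auto simp: set_mult_def intro!: bexI[of _ "\<one>" H])
next
  case (large_mono N M)
  interpret H: subgroup H G by fact
  interpret M: normal M G by fact
  show ?case
    using mono_set_mult[of H H N M G] large_mono set_mult_closed[OF H.subset M.subset] by blast
next
  case (large_refine N M)
  interpret H: subgroup H G by fact
  interpret M: normal M G by fact
  interpret N: normal N G by (rule large_normal) fact
  have sub: "subgroup (H <#> M) G"
    using mult_norm_subgroup[OF M.normal_axioms assms(2)] commut_normal[OF assms(2) M.normal_axioms]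
    by simp
  have conj: "g \<otimes> x \<otimes> inv g \<in> H <#> M" if g: "g \<in> carrier G" and x: "x \<in> H <#> M" for g x
  proof -
    obtain k m where k: "k \<in> H" and m: "m \<in> M" and x: "x = k \<otimes> m"
      using x by (auto simp: set_mult_def)
    have "g \<in> H <#> N"
      using g large_refine.IH by simp
    then obtain h n where h: "h \<in> H" and n: "n \<in> N" and g: "g = h \<otimes> n"
      by (auto simp: set_mult_def)
    have [simp]: "k \<in> carrier G" "h \<in> carrier G" "m \<in> carrier G" "n \<in> carrier G"
      using k m h n H.subset M.subset N.subset by auto
    have "inv k \<otimes> commutator G n k \<otimes> k \<in> M"
      by (rule normal_conj_closed[OF M.normal_axioms large_refine.hyps(4)[OF n]]) simp_all
    moreover have "n \<otimes> m \<otimes> inv n \<in> M"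
      using m by (intro normal_conj_closed M.normal_axioms) auto
    ultimately have *: "h \<otimes> (inv k \<otimes> commutator G n k \<otimes> k \<otimes> (n \<otimes> m \<otimes> inv n)) \<otimes> inv h \<in> M"
      by (intro normal_conj_closed M.normal_axioms) auto
    have "g \<otimes> x \<otimes> inv g = (h \<otimes> k \<otimes> inv h) \<otimes>
      (h \<otimes> (inv k \<otimes> commutator G n k \<otimes> k \<otimes> (n \<otimes> m \<otimes> inv n)) \<otimes> inv h)"
      unfolding x g by (simp add: commutator_def m_assoc inv_mult_group)
    moreover have "h \<otimes> k \<otimes> inv h \<in> H"
      using k h by simp
    ultimately show ?thesis
      using * unfolding set_mult_def by blast
  qed
  have "H <#> M \<lhd> G"
    using sub conj by (rule normal_invI)
  moreover have "H \<subseteq> H <#> M"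
  proof
    fix h assume "h \<in> H"
    then have "h \<otimes> \<one> \<in> H <#> M"
      using M.one_closed unfolding set_mult_def by blast
    then show "h \<in> H <#> M"
      using \<open>h \<in> H\<close> by simp
  qed
  ultimately show ?case
    by (rule full)
qed

lemma subgroup_eq_if_contains_generators:
  assumes "S \<subseteq> carrier G" "generate G S = carrier G" "subgroup H G" "S \<subseteq> H"
  shows "H = carrier G"
  using generate_subgroup_incl[OF assms(4,3)] subgroup.subset[OF assms(3)] assms(2) by simp

text \<open>The elements that commute with \<open>x\<close> modulo \<open>M\<close> form a subgroup.\<close>

lemma commutator_generators:
  assumes M: "M \<lhd> G" and S: "S \<subseteq> carrier G" "generate G S = carrier G" and x: "x \<in> carrier G"
    and comm: "\<And>s. s \<in> S \<Longrightarrow> commutator G x s \<in> M" and g: "g \<in> carrier G"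
  shows "commutator G x g \<in> M"
proof -
  interpret M: normal M G by fact
  have "g \<in> generate G S"
    using g S by simp
  then show ?thesis
  proof induction
    case one
    show ?case using x by (simp add: commutator_def)
  next
    case (incl h)
    then show ?case by (rule comm)
  next
    case (inv h)
    then have [simp]: "h \<in> carrier G" using S by auto
    have "inv h \<otimes> inv (commutator G x h) \<otimes> h \<in> M"
      using comm[OF inv] by (intro normal_conj_closed M) auto
    moreover have "inv h \<otimes> inv (commutator G x h) \<otimes> h = commutator G x (inv h)"
      using x by (simp add: commutator_def m_assoc inv_mult_group)
    ultimately show ?case by simp
  next
    case (eng g h)
    then have [simp]: "g \<in> carrier G" "h \<in> carrier G" using S by auto
    have "g \<otimes> commutator G x h \<otimes> inv g \<in> M"
      using eng by (intro normal_conj_closed M) auto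
    then have "commutator G x g \<otimes> (g \<otimes> commutator G x h \<otimes> inv g) \<in> M"
      using eng by simp
    moreover have "commutator G x g \<otimes> (g \<otimes> commutator G x h \<otimes> inv g) = commutator G x (g \<otimes> h)"
      using x by (simp add: commutator_def m_assoc inv_mult_group)
    ultimately show ?case by simp
  qed
qed

lemma commutator_swap:
  assumes "M \<lhd> G" "x \<in> carrier G" "y \<in> carrier G" "commutator G x y \<in> M"
  shows "commutator G y x \<in> M"
proof -
  interpret M: normal M G by fact
  have "inv (commutator G x y) \<in> M" using assms by simp
  then show ?thesis using assms by (simp add: commutator_def m_assoc inv_mult_group)
qed

text \<open>Modulo \<open>M\<close> the group is abelian, so squaring is a homomorphism.\<close>

lemma square_generators:
  assumes M: "M \<lhd> G" and S: "S \<subseteq> carrier G" "generate G S = carrier G"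
    and comm: "\<And>x y. x \<in> carrier G \<Longrightarrow> y \<in> carrier G \<Longrightarrow> commutator G x y \<in> M"
    and sq: "\<And>s. s \<in> S \<Longrightarrow> s \<otimes> s \<in> M" and g: "g \<in> carrier G"
  shows "g \<otimes> g \<in> M"
proof -
  interpret M: normal M G by fact
  have "g \<in> generate G S"
    using g S by simp
  then show ?thesis
  proof induction
    case one
    show ?case by simp
  next
    case (incl h)
    then show ?case by (rule sq)
  next
    case (inv h)
    then have [simp]: "h \<in> carrier G" using S by auto
    have "inv (h \<otimes> h) \<in> M"
      using sq[OF inv] by simp
    then show ?case by (simp add: inv_mult_group)
  next
    case (eng g h)
    then have [simp]: "g \<in> carrier G" "h \<in> carrier G" using S by auto
    have "g \<otimes> commutator G h g \<otimes> inv g \<in> M"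
      using comm by (intro normal_conj_closed M) auto
    then have "(g \<otimes> commutator G h g \<otimes> inv g) \<otimes> (g \<otimes> g) \<otimes> (h \<otimes> h) \<in> M"
      using eng by simp
    moreover have "(g \<otimes> commutator G h g \<otimes> inv g) \<otimes> (g \<otimes> g) \<otimes> (h \<otimes> h) = (g \<otimes> h) \<otimes> (g \<otimes> h)"
      by (simp add: commutator_def m_assoc inv_mult_group)
    ultimately show ?case by simp
  qed
qed

end

context group
begin

text \<open>The preimage in \<open>G\<close> of the elements of exponent 2 in the centre of \<open>G/M\<close>.\<close>

definition central_mod :: "'a set \<Rightarrow> 'a set" where
  "central_mod M = {x \<in> carrier G. (\<forall>g \<in> carrier G. commutator G x g \<in> M) \<and> x \<otimes> x \<in> M}"

lemma central_mod_superset: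
  assumes "M \<lhd> G" shows "M \<subseteq> central_mod M"
proof -
  interpret normal M G by fact
  show ?thesis
    using assms by (auto simp: central_mod_def commutator_in_normal)
qed

lemma central_mod_normal:
  assumes M: "M \<lhd> G"
  shows "central_mod M \<lhd> G"
proof -
  interpret M: normal M G by fact
  have mult: "x \<otimes> y \<in> central_mod M" if "x \<in> central_mod M" "y \<in> central_mod M" for x y
  proof -
    have xy [simp]: "x \<in> carrier G" "y \<in> carrier G" "x \<otimes> x \<in> M" "y \<otimes> y \<in> M"
      and comm: "\<And>g. g \<in> carrier G \<Longrightarrow> commutator G x g \<in> M" "\<And>g. g \<in> carrier G \<Longrightarrow> commutator G y g \<in> M"
      using that by (auto simp: central_mod_def)
    have "commutator G (x \<otimes> y) g \<in> M" if g: "g \<in> carrier G" for g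
    proof -
      have "x \<otimes> commutator G y g \<otimes> inv x \<otimes> commutator G x g \<in> M"
        using normal_conj_closed(1)[OF M comm(2)[OF g], of x] comm(1)[OF g] by simp
      then show ?thesis using g by (simp add: commutator_def m_assoc inv_mult_group)
    qed
    moreover have "(x \<otimes> commutator G y x \<otimes> inv x) \<otimes> ((x \<otimes> x) \<otimes> (y \<otimes> y)) \<in> M"
      using normal_conj_closed(1)[OF M comm(2)[of x], of x] by simp
    then have "(x \<otimes> y) \<otimes> (x \<otimes> y) \<in> M"
      by (simp add: commutator_def m_assoc)
    ultimately show ?thesis by (simp add: central_mod_def)
  qed
  have inv: "inv x \<in> central_mod M" if "x \<in> central_mod M" for x
  proof -
    have x [simp]: "x \<in> carrier G" "x \<otimes> x \<in> M"
      and comm: "\<And>g. g \<in> carrier G \<Longrightarrow> commutator G x g \<in> M"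
      using that by (auto simp: central_mod_def)
    have "commutator G (inv x) g \<in> M" if g: "g \<in> carrier G" for g
    proof -
      have "inv x \<otimes> inv (commutator G x g) \<otimes> x \<in> M"
        using g comm by (intro normal_conj_closed M M.m_inv_closed) auto
      then show ?thesis using g by (simp add: commutator_def m_assoc inv_mult_group)
    qed
    moreover have "inv (x \<otimes> x) \<in> M" by simp
    then have "inv x \<otimes> inv x \<in> M" by (simp add: inv_mult_group)
    ultimately show ?thesis by (simp add: central_mod_def)
  qed
  have conj: "h \<otimes> x \<otimes> inv h \<in> central_mod M" if x: "x \<in> central_mod M" and h [simp]: "h \<in> carrier G" for x h
  proof -
    have x [simp]: "x \<in> carrier G" "x \<otimes> x \<in> M"
      and comm: "\<And>g. g \<in> carrier G \<Longrightarrow> commutator G x g \<in> M"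
      using x by (auto simp: central_mod_def)
    have "commutator G (h \<otimes> x \<otimes> inv h) g \<in> M" if g: "g \<in> carrier G" for g
    proof -
      have "h \<otimes> commutator G x (inv h \<otimes> g \<otimes> h) \<otimes> inv h \<in> M"
        using g comm by (intro normal_conj_closed M) auto
      then show ?thesis using g by (simp add: commutator_def m_assoc inv_mult_group)
    qed
    moreover have "h \<otimes> (x \<otimes> x) \<otimes> inv h \<in> M"
      by (intro normal_conj_closed M) auto
    then have "(h \<otimes> x \<otimes> inv h) \<otimes> (h \<otimes> x \<otimes> inv h) \<in> M"
      by (simp add: m_assoc)
    ultimately show ?thesis by (simp add: central_mod_def)
  qed
  have "central_mod M \<subseteq> carrier G" by (auto simp: central_mod_def)
  moreover have "\<one> \<in> central_mod M" using central_mod_superset[OF M] M.one_closed by blast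
  ultimately have "subgroup (central_mod M) G"
    using mult inv by (simp add: subgroup_def)
  then show ?thesis
    using conj by (rule normal_invI)
qed

text \<open>Two steps of a central series, checked on generators: \<open>G\<close>, then the elements central modulo \<open>M\<close>,
  then \<open>M\<close>.\<close>

lemma large_if_central_mod_generators:
  assumes M: "M \<lhd> G" and S: "S \<subseteq> carrier G" "generate G S = carrier G"
    and comm: "\<And>s s'. s \<in> S \<Longrightarrow> s' \<in> S \<Longrightarrow> commutator G s s' \<in> central_mod M"
    and sq: "\<And>s. s \<in> S \<Longrightarrow> s \<otimes> s \<in> central_mod M"
  shows "large G M"
proof -
  note Z = central_mod_normal[OF M]
  have "commutator G s g \<in> central_mod M" if "s \<in> S" "g \<in> carrier G" for s g
    using commutator_generators[OF Z S, of s g] that comm S by blast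
  then have all: "commutator G x g \<in> central_mod M" if "x \<in> carrier G" "g \<in> carrier G" for x g
    using commutator_generators[OF Z S, of x g] commutator_swap[OF Z] that S by blast
  have "large G (central_mod M)"
  proof (rule large.large_refine[OF large.large_carrier Z])
    show "g \<otimes> g \<in> central_mod M" if "g \<in> carrier G" for g
      using square_generators[OF Z S all sq that] by simp
  qed (auto simp: all, auto simp: central_mod_def)
  then show ?thesis
    by (rule large.large_refine[OF _ M central_mod_superset[OF M]]) (auto simp: central_mod_def)
qed

end

context group
begin

text \<open>Let \<open>N/M\<close> be one step of the series. The pairs \<open>(x, y)\<close> in \<open>N \<times> N\<close> with \<open>x y \<in> M\<close> will be
  inserted between \<open>N \<times> N\<close> and \<open>M \<times> M\<close>. The following lemmas say that they form a subgroup,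
  that it is invariant under conjugation, and what happens to commutators with an element that
  exchanges the coordinates.\<close>

context
  fixes N M
  assumes M: "M \<lhd> G" and N: "N \<lhd> G" and MN: "M \<subseteq> N"
    and central: "\<And>n g. n \<in> N \<Longrightarrow> g \<in> carrier G \<Longrightarrow> commutator G n g \<in> M"
    and exp2: "\<And>n. n \<in> N \<Longrightarrow> n \<otimes> n \<in> M"
begin

interpretation M: normal M G by (rule M)
interpretation N: normal N G by (rule N)

lemma central_swap: "x \<in> carrier G \<Longrightarrow> y \<in> N \<Longrightarrow> commutator G x y \<in> M"
  using commutator_swap[OF M, of y x] central by simp

lemma central_prod_commute:
  assumes "x \<in> N" "y \<in> N" "x \<otimes> y \<in> M"
  shows "y \<otimes> x \<in> M"
proof -
  have "y \<otimes> (x \<otimes> y) \<otimes> inv y \<in> M"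
    using assms by (intro normal_conj_closed M) auto
  then show ?thesis using assms by (simp add: m_assoc)
qed

lemma central_prod_mult:
  assumes x: "x \<in> N" "y \<in> N" "x \<otimes> y \<in> M" and x': "x' \<in> N" "y' \<in> N" "x' \<otimes> y' \<in> M"
  shows "x \<otimes> x' \<otimes> (y \<otimes> y') \<in> M"
proof -
  have "x \<otimes> commutator G x' y \<otimes> inv x \<in> M"
    using assms by (intro normal_conj_closed M central) auto
  then have "x \<otimes> commutator G x' y \<otimes> inv x \<otimes> ((x \<otimes> y) \<otimes> (x' \<otimes> y')) \<in> M"
    using assms by simp
  moreover have "x \<otimes> commutator G x' y \<otimes> inv x \<otimes> ((x \<otimes> y) \<otimes> (x' \<otimes> y')) = x \<otimes> x' \<otimes> (y \<otimes> y')"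
    using assms by (simp add: commutator_def m_assoc)
  ultimately show ?thesis by simp
qed

lemma central_prod_inv:
  assumes "x \<in> N" "y \<in> N" "x \<otimes> y \<in> M"
  shows "inv x \<otimes> inv y \<in> M"
proof -
  have "inv (y \<otimes> x) \<in> M"
    using central_prod_commute[OF assms] by simp
  then show ?thesis using assms by (simp add: inv_mult_group)
qed

lemma central_prod_conj:
  assumes "x \<in> N" "y \<in> N" "x \<otimes> y \<in> M" "u \<in> carrier G" "v \<in> carrier G"
  shows "(u \<otimes> x \<otimes> inv u) \<otimes> (v \<otimes> y \<otimes> inv v) \<in> M"
proof -
  have "x \<otimes> commutator G v y \<otimes> inv x \<in> M"
    using assms by (intro normal_conj_closed M central_swap) auto
  then have "commutator G u x \<otimes> (x \<otimes> commutator G v y \<otimes> inv x) \<otimes> (x \<otimes> y) \<in> M"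
    using assms central_swap by simp
  moreover have "commutator G u x \<otimes> (x \<otimes> commutator G v y \<otimes> inv x) \<otimes> (x \<otimes> y)
      = (u \<otimes> x \<otimes> inv u) \<otimes> (v \<otimes> y \<otimes> inv v)"
    using assms by (simp add: commutator_def m_assoc)
  ultimately show ?thesis by simp
qed

text \<open>The two factors are the coordinates of the commutator of \<open>(x, y)\<close> with an element that exchanges the
  coordinates. Modulo \<open>M\<close> they are \<open>x y\<^sup>-\<^sup>1\<close> and \<open>y x\<^sup>-\<^sup>1\<close>.\<close>

lemma central_twist:
  assumes "x \<in> N" "y \<in> N" "u \<in> carrier G" "v \<in> carrier G"
  shows "(x \<otimes> (u \<otimes> inv y \<otimes> inv u)) \<otimes> (y \<otimes> (v \<otimes> inv x \<otimes> inv v)) \<in> M"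
proof -
  have "x \<otimes> commutator G u (inv y) \<otimes> inv x \<in> M"
    using assms by (intro normal_conj_closed M central_swap) auto
  then have "(x \<otimes> commutator G u (inv y) \<otimes> inv x) \<otimes> commutator G x v \<in> M"
    using assms central by simp
  moreover have "(x \<otimes> commutator G u (inv y) \<otimes> inv x) \<otimes> commutator G x v
      = (x \<otimes> (u \<otimes> inv y \<otimes> inv u)) \<otimes> (y \<otimes> (v \<otimes> inv x \<otimes> inv v))"
    using assms by (simp add: commutator_def m_assoc inv_mult_group)
  ultimately show ?thesis by simp
qed

text \<open>Modulo \<open>M\<close> the assumption gives \<open>y\<^sup>-\<^sup>1 = x\<close>, and the element becomes \<open>x\<^sup>2\<close>.\<close>

lemma central_twist_prod:
  assumes "x \<in> N" "y \<in> N" "x \<otimes> y \<in> M" "u \<in> carrier G"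
  shows "x \<otimes> (u \<otimes> inv y \<otimes> inv u) \<in> M"
proof -
  have "x \<otimes> (u \<otimes> inv (x \<otimes> y) \<otimes> inv u) \<otimes> inv x \<in> M"
    using assms by (intro normal_conj_closed M) auto
  moreover have "x \<otimes> commutator G u x \<otimes> inv x \<in> M"
    using assms by (intro normal_conj_closed M central_swap) auto
  ultimately have "(x \<otimes> (u \<otimes> inv (x \<otimes> y) \<otimes> inv u) \<otimes> inv x) \<otimes> ((x \<otimes> commutator G u x \<otimes> inv x) \<otimes> (x \<otimes> x)) \<in> M"
    using exp2 assms by simp
  moreover have "(x \<otimes> (u \<otimes> inv (x \<otimes> y) \<otimes> inv u) \<otimes> inv x) \<otimes> ((x \<otimes> commutator G u x \<otimes> inv x) \<otimes> (x \<otimes> x))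
     = x \<otimes> (u \<otimes> inv y \<otimes> inv u)"
    using assms by (simp add: commutator_def m_assoc inv_mult_group)
  ultimately show ?thesis by simp
qed

end

end

section \<open>Finite index and solvable subgroups\<close>

lemma (in group) finite_index_if_finite_image:
  assumes N: "subgroup N G" and fin: "finite (\<phi> ` carrier G)"
    and eq: "\<And>g h. g \<in> carrier G \<Longrightarrow> h \<in> carrier G \<Longrightarrow> \<phi> g = \<phi> h \<Longrightarrow> g \<otimes> inv h \<in> N"
  shows "finite_index G N"
proof -
  interpret N: subgroup N G by fact
  have "rcosets N \<subseteq> (\<lambda>b. N #> inv_into (carrier G) \<phi> b) ` \<phi> ` carrier G"
  proof
    fix K assume "K \<in> rcosets N"
    then obtain g where g: "g \<in> carrier G" "K = N #> g" by (auto simp: RCOSETS_def)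
    let ?h = "inv_into (carrier G) \<phi> (\<phi> g)"
    have h: "?h \<in> carrier G" "\<phi> ?h = \<phi> g"
      using g(1) by (auto simp: inv_into_into f_inv_into_f)
    have "g \<otimes> inv ?h \<in> N"
      using eq[OF g(1) h(1)] h(2) by simp
    then have "g \<in> N #> ?h"
      using g h by (force simp: r_coset_def m_assoc intro!: bexI[of _ "g \<otimes> inv ?h" N])
    then have "K = N #> ?h"
      using repr_independence[OF _ h(1) N] g by auto
    then show "K \<in> (\<lambda>b. N #> inv_into (carrier G) \<phi> b) ` \<phi> ` carrier G"
      using g by blast
  qed
  then show ?thesis
    unfolding finite_index_def using fin finite_subset by blast
qed

context group
begin

text \<open>\<open>N\<close> is the kernel of the action on the cosets of \<open>H\<close>. It is nontrivial because an infinite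
  group has no injection into the finitely many self-maps of a finite set.\<close>

lemma finite_index_normal_core:
  assumes inf: "infinite (carrier G)" and H: "subgroup H G" and fin: "finite_index G H"
  obtains N where "N \<lhd> G" "N \<subseteq> H" "N \<noteq> {\<one>}"
proof
  interpret H: subgroup H G by fact
  define N where "N = {g \<in> carrier G. \<forall>K \<in> rcosets H. K #> g = K}"
  have sub: "K \<subseteq> carrier G" if "K \<in> rcosets H" for K
    using that H.subset by (auto simp: RCOSETS_def r_coset_def)
  have act: "K #> g \<in> rcosets H" if "K \<in> rcosets H" "g \<in> carrier G" for K g
  proof -
    obtain k where k: "k \<in> carrier G" "K = H #> k" using \<open>K \<in> rcosets H\<close> by (auto simp: RCOSETS_def)
    then have "K #> g = H #> (k \<otimes> g)" using H.subset that by (simp add: coset_mult_assoc)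
    then show ?thesis using k that by (auto simp: RCOSETS_def)
  qed
  have "subgroup N G"
  proof
    show "inv g \<in> N" if g: "g \<in> N" for g
    proof -
      have "K #> inv g = K" if K: "K \<in> rcosets H" for K
      proof -
        have "K #> inv g = (K #> g) #> inv g" using g K by (simp add: N_def)
        also have "\<dots> = K" using sub[OF K] g by (simp add: N_def coset_mult_assoc)
        finally show ?thesis .
      qed
      then show ?thesis using g by (simp add: N_def)
    qed
    show "g \<otimes> h \<in> N" if "g \<in> N" "h \<in> N" for g h
      using that sub by (simp add: N_def flip: coset_mult_assoc)
  qed (use sub in \<open>auto simp: N_def\<close>)
  then show "N \<lhd> G"
  proof (rule normal_invI)
    fix x g assume x: "x \<in> carrier G" and g: "g \<in> N"
    have "K #> (x \<otimes> g \<otimes> inv x) = K" if K: "K \<in> rcosets H" for K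
    proof -
      have "K #> (x \<otimes> g \<otimes> inv x) = ((K #> x) #> g) #> inv x"
        using sub[OF K] sub[OF act[OF K x]] x g by (simp add: N_def coset_mult_assoc m_assoc)
      also have "(K #> x) #> g = K #> x" using act[OF K x] g by (simp add: N_def)
      also have "(K #> x) #> inv x = K" using sub[OF K] x by (simp add: coset_mult_assoc)
      finally show ?thesis .
    qed
    then show "x \<otimes> g \<otimes> inv x \<in> N" using x g by (simp add: N_def)
  qed
  show "N \<subseteq> H"
  proof
    fix g assume g: "g \<in> N"
    have "H \<in> rcosets H" using H.subset by (metis coset_mult_one one_closed rcosetsI)
    then have "H #> g = H" using g by (simp add: N_def)
    then show "g \<in> H" using g H by (simp add: N_def coset_join1)
  qed
  let ?R = "\<lambda>g. restrict (\<lambda>K. K #> g) (rcosets H)"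
  have sub_PiE: "?R ` carrier G \<subseteq> rcosets H \<rightarrow>\<^sub>E rcosets H"
    using act by (intro image_subsetI PiE_I) auto
  have "finite (?R ` carrier G)"
    using fin unfolding finite_index_def by (intro finite_subset[OF sub_PiE] finite_PiE)
  then have "\<not> inj_on ?R (carrier G)" using inf finite_imageD by blast
  then obtain g h where gh: "g \<in> carrier G" "h \<in> carrier G" "g \<noteq> h" "?R g = ?R h"
    by (auto simp: inj_on_def)
  have "g \<otimes> inv h \<in> N"
  proof -
    have "K #> (g \<otimes> inv h) = K" if K: "K \<in> rcosets H" for K
    proof -
      have "K #> g = K #> h" using fun_cong[OF gh(4), of K] K by simp
      then have "K #> (g \<otimes> inv h) = (K #> h) #> inv h"
        using sub[OF K] gh by (simp flip: coset_mult_assoc)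
      then show ?thesis using sub[OF K] gh by (simp add: coset_mult_assoc)
    qed
    then show ?thesis using gh by (simp add: N_def)
  qed
  moreover have "g \<otimes> inv h \<noteq> \<one>" using gh inv_equality inv_inv by (metis inv_closed)
  ultimately show "N \<noteq> {\<one>}" by blast
qed

text \<open>The last nontrivial term of the derived series of \<open>N\<close> is abelian, and it is normal in \<open>G\<close> because
  all terms of this series are.\<close>

lemma solvable_normal_contains_abelian:
  assumes H: "subgroup H G" "solvable (G\<lparr>carrier := H\<rparr>)" and N: "N \<lhd> G" "N \<subseteq> H" "N \<noteq> {\<one>}"
  obtains A where "A \<lhd> G" "A \<noteq> {\<one>}" "\<And>x y. x \<in> A \<Longrightarrow> y \<in> A \<Longrightarrow> x \<otimes> y = y \<otimes> x"
proof -
  have cons: "(derived (G\<lparr>carrier := H\<rparr>) ^^ n) H = (derived G ^^ n) H \<and> (derived G ^^ n) H \<subseteq> H" for n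
  proof (induction n)
    case (Suc n)
    then show ?case using derived_consistent[OF _ H(1)] derived_incl[OF _ H(1)]
      by (simp add: comp_apply)
  qed (simp add: id_apply)
  interpret GH: group "G\<lparr>carrier := H\<rparr>" by (rule subgroup_imp_group[OF H(1)])
  obtain n where "(derived G ^^ n) H = {\<one>}"
    using H(2) cons by (auto simp: GH.solvable_iff_trivial_derived_seq)
  then have ex: "(derived G ^^ n) N \<subseteq> {\<one>}"
    using mono_exp_of_derived[OF N(2), of n] by simp
  define k where "k = (LEAST k. (derived G ^^ k) N \<subseteq> {\<one>})"
  have k: "(derived G ^^ k) N \<subseteq> {\<one>}"
    unfolding k_def by (rule LeastI) (rule ex)
  have nrm: "(derived G ^^ j) N \<lhd> G" for j
    by (induction j) (simp_all add: N derived_is_normal comp_apply id_apply)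
  have one: "\<one> \<in> (derived G ^^ j) N" for j
    using normal_imp_subgroup[OF nrm] by (rule subgroup.one_closed)
  have "k \<noteq> 0" using k N(3) one[of 0] by (cases k) (auto simp: id_apply)
  then obtain j where j: "k = Suc j" by (cases k) auto
  define A where "A = (derived G ^^ j) N"
  have "\<not> A \<subseteq> {\<one>}"
    unfolding A_def using not_less_Least[of j "\<lambda>k. (derived G ^^ k) N \<subseteq> {\<one>}"] j
    by (simp flip: k_def)
  then have "A \<noteq> {\<one>}" by blast
  moreover have A: "A \<lhd> G" unfolding A_def by (rule nrm)
  moreover have "x \<otimes> y = y \<otimes> x" if xy: "x \<in> A" "y \<in> A" for x y
  proof -
    have G: "x \<in> carrier G" "y \<in> carrier G"
      using xy subgroup.mem_carrier[OF normal_imp_subgroup[OF A]] by auto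
    have "x \<otimes> y \<otimes> inv x \<otimes> inv y \<in> derived G A"
      unfolding derived_def by (rule generate.incl) (use xy in auto)
    moreover have "derived G A \<subseteq> {\<one>}" using k by (simp add: j comp_apply A_def)
    ultimately have "x \<otimes> y \<otimes> inv x \<otimes> inv y = \<one>" by blast
    then have "x \<otimes> y \<otimes> inv x \<otimes> inv y \<otimes> (y \<otimes> x) = \<one> \<otimes> (y \<otimes> x)" by simp
    then show ?thesis using G by (simp add: m_assoc)
  qed
  ultimately show thesis using that by blast
qed

end

section \<open>The Grigorchuk group and its sections\<close>

interpretation grig: group grigorchuk_group
  by (rule group_grigorchuk_group)

abbreviation "Gr \<equiv> carrier grigorchuk_group"
abbreviation "iv x \<equiv> inv\<^bsub>grigorchuk_group\<^esub> x"
abbreviation "comm \<equiv> commutator grigorchuk_group"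

text \<open>The automorphism with sections \<open>x\<close> at \<open>0\<close> and \<open>y\<close> at \<open>1\<close>.\<close>

fun pr :: "(bool list \<Rightarrow> bool list) \<Rightarrow> (bool list \<Rightarrow> bool list) \<Rightarrow> bool list \<Rightarrow> bool list" where
  "pr x y [] = []"
| "pr x y (False # w) = False # x w"
| "pr x y (True # w) = True # y w"

lemma gens_in_tree: "{grig_a, grig_b, grig_c, grig_d} \<subseteq> carrier tree_aut_group"
  using grig_generators_in_tree_auts by (simp add: tree_aut_group_def)

lemma Gr_tree_auts: "Gr \<subseteq> tree_auts"
  using group.generate_incl[OF group_tree_aut_group gens_in_tree]
  by (simp add: grigorchuk_group_def tree_aut_group_def)

lemma mult_grig [simp]: "f \<in> Gr \<Longrightarrow> g \<in> Gr \<Longrightarrow> f \<otimes>\<^bsub>grigorchuk_group\<^esub> g = f \<circ> g"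
  using mult_tree_aut_group[of f g] Gr_tree_auts by (auto simp: grigorchuk_group_def)

lemma one_grig [simp]: "\<one>\<^bsub>grigorchuk_group\<^esub> = id"
  by (auto simp: grigorchuk_group_def tree_aut_group_def BijGroup_def restrict_def)

lemma id_Gr [simp]: "id \<in> Gr"
  using grig.one_closed by (simp del: grig.one_closed)

lemma comp_Gr [simp]: "f \<in> Gr \<Longrightarrow> g \<in> Gr \<Longrightarrow> f \<circ> g \<in> Gr"
  using grig.m_closed[of f g] by (simp del: grig.m_closed)

lemma iv_cancel [simp]:
  assumes "x \<in> Gr"
  shows "iv x \<circ> x = id" "x \<circ> iv x = id" "iv x \<circ> (x \<circ> y) = y" "x \<circ> (iv x \<circ> y) = y"
proof -
  show 1: "iv x \<circ> x = id" and 2: "x \<circ> iv x = id"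
    using grig.l_inv[OF assms] grig.r_inv[OF assms] assms by simp_all
  show "iv x \<circ> (x \<circ> y) = y" "x \<circ> (iv x \<circ> y) = y"
    by (simp_all add: 1 2 flip: comp_assoc)
qed

lemma iv_comp [simp]: "x \<in> Gr \<Longrightarrow> y \<in> Gr \<Longrightarrow> iv (x \<circ> y) = iv y \<circ> iv x"
  using grig.inv_mult_group[of x y] by simp

lemma iv_unique: "x \<in> Gr \<Longrightarrow> y \<in> Gr \<Longrightarrow> x \<circ> y = id \<Longrightarrow> iv y = x"
  using grig.inv_equality[of x y] by simp

lemma iv_id [simp]: "iv id = id"
  by (simp add: iv_unique)

lemma comm_eq: "x \<in> Gr \<Longrightarrow> y \<in> Gr \<Longrightarrow> comm x y = x \<circ> y \<circ> iv x \<circ> iv y"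
  by (simp add: commutator_def)

lemma gens_Gr [simp]: "grig_a \<in> Gr" "grig_b \<in> Gr" "grig_c \<in> Gr" "grig_d \<in> Gr"
  by (auto simp: grigorchuk_group_def intro: generate.incl)

lemma generate_grig: "generate grigorchuk_group {grig_a, grig_b, grig_c, grig_d} = Gr"
proof -
  have "subgroup (generate tree_aut_group {grig_a, grig_b, grig_c, grig_d}) tree_aut_group"
    by (intro group.generate_is_subgroup group_tree_aut_group gens_in_tree)
  then show ?thesis
    using group.generate_consistent[OF group_tree_aut_group, of "{grig_a, grig_b, grig_c, grig_d}"
        "generate tree_aut_group {grig_a, grig_b, grig_c, grig_d}"]
    by (auto simp: grigorchuk_group_def intro: generate.incl)
qed

lemma gens_invol [simp]:
  "grig_a \<circ> grig_a = id" "grig_b \<circ> grig_b = id" "grig_c \<circ> grig_c = id" "grig_d \<circ> grig_d = id"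
  "grig_a \<circ> (grig_a \<circ> x) = x" "grig_b \<circ> (grig_b \<circ> x) = x"
  "grig_c \<circ> (grig_c \<circ> x) = x" "grig_d \<circ> (grig_d \<circ> x) = x"
  by (auto simp: fun_eq_iff grig_a_involution grig_bcd_involution)

lemma iv_gens [simp]: "iv grig_a = grig_a" "iv grig_b = grig_b" "iv grig_c = grig_c" "iv grig_d = grig_d"
  by (simp_all add: iv_unique)

text \<open>The generators are involutions, so every element is a product of generators.\<close>

lemma grig_induct [consumes 1, case_names id left]:
  assumes "g \<in> Gr" and "P id"
    and "\<And>s g. s \<in> {grig_a, grig_b, grig_c, grig_d} \<Longrightarrow> g \<in> Gr \<Longrightarrow> P g \<Longrightarrow> P (s \<circ> g)"
  shows "P g"
proof -
  have "g \<in> generate grigorchuk_group {grig_a, grig_b, grig_c, grig_d}"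
    using assms(1) generate_grig by simp
  then have "\<forall>h \<in> Gr. P h \<longrightarrow> P (g \<circ> h) \<and> g \<circ> h \<in> Gr"
  proof induction
    case one
    show ?case by simp
  next
    case (incl h)
    moreover have "h \<in> Gr" using incl by auto
    ultimately show ?case using assms(3) comp_Gr by blast
  next
    case (inv h)
    moreover have "iv h = h" "h \<in> Gr" using inv by auto
    ultimately show ?case using assms(3) comp_Gr by metis
  next
    case (eng g h)
    then have "g \<in> Gr" "h \<in> Gr" using generate_grig by auto
    then show ?case using eng by (simp add: comp_assoc)
  qed
  then show ?thesis using assms(2) by (metis comp_id id_Gr)
qed

lemma pr_comp [simp]: "pr x y \<circ> pr x' y' = pr (x \<circ> x') (y \<circ> y')"
  "pr x y \<circ> (pr x' y' \<circ> z) = pr (x \<circ> x') (y \<circ> y') \<circ> z"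
proof -
  show *: "pr x y \<circ> pr x' y' = pr (x \<circ> x') (y \<circ> y')"
  proof
    fix w show "(pr x y \<circ> pr x' y') w = pr (x \<circ> x') (y \<circ> y') w"
      by (cases "(x, y, w)" rule: pr.cases) auto
  qed
  show "pr x y \<circ> (pr x' y' \<circ> z) = pr (x \<circ> x') (y \<circ> y') \<circ> z"
    by (simp add: * flip: comp_assoc)
qed

lemma pr_id [simp]: "pr id id = id"
proof
  fix w show "pr id id w = id w"
    by (cases "(id :: bool list \<Rightarrow> bool list, id :: bool list \<Rightarrow> bool list, w)" rule: pr.cases) auto
qed

lemma a_pr [simp]: "grig_a \<circ> pr x y = pr y x \<circ> grig_a" "grig_a \<circ> (pr x y \<circ> z) = pr y x \<circ> (grig_a \<circ> z)"
proof -
  show *: "grig_a \<circ> pr x y = pr y x \<circ> grig_a"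
  proof
    fix w show "(grig_a \<circ> pr x y) w = (pr y x \<circ> grig_a) w"
      by (cases "(x, y, w)" rule: pr.cases) auto
  qed
  show "grig_a \<circ> (pr x y \<circ> z) = pr y x \<circ> (grig_a \<circ> z)"
    by (metis * comp_assoc)
qed

lemma pr_eq_iff [simp]: "pr x y = pr x' y' \<longleftrightarrow> x = x' \<and> y = y'"
proof
  assume eq: "pr x y = pr x' y'"
  show "x = x' \<and> y = y'"
    using fun_cong[OF eq, of "False # _"] fun_cong[OF eq, of "True # _"] by auto
qed simp

lemma pr_neq_a [simp]: "pr x y \<noteq> pr x' y' \<circ> grig_a"
proof
  assume "pr x y = pr x' y' \<circ> grig_a"
  from fun_cong[OF this, of "[False]"] show False by simp
qed

lemma pr_eq_id_iff [simp]: "pr x y = id \<longleftrightarrow> x = id \<and> y = id"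
  using pr_eq_iff[of x y id id] by simp

lemma bcd_pr: "grig_b = pr grig_a grig_c" "grig_c = pr grig_a grig_d" "grig_d = pr id grig_b"
proof -
  have "grig_b w = pr grig_a grig_c w" "grig_c w = pr grig_a grig_d w" "grig_d w = pr id grig_b w" for w
    by (cases "(grig_a, grig_a, w)" rule: pr.cases; simp)+
  then show "grig_b = pr grig_a grig_c" "grig_c = pr grig_a grig_d" "grig_d = pr id grig_b"
    by blast+
qed

lemma bcd_mult [simp]:
  "grig_b \<circ> grig_c = grig_d" "grig_c \<circ> grig_b = grig_d"
  "grig_b \<circ> grig_d = grig_c" "grig_d \<circ> grig_b = grig_c"
  "grig_c \<circ> grig_d = grig_b" "grig_d \<circ> grig_c = grig_b"
  "grig_b \<circ> (grig_c \<circ> x) = grig_d \<circ> x" "grig_c \<circ> (grig_b \<circ> x) = grig_d \<circ> x"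
  "grig_b \<circ> (grig_d \<circ> x) = grig_c \<circ> x" "grig_d \<circ> (grig_b \<circ> x) = grig_c \<circ> x"
  "grig_c \<circ> (grig_d \<circ> x) = grig_b \<circ> x" "grig_d \<circ> (grig_c \<circ> x) = grig_b \<circ> x"
proof -
  have *: "grig_b (grig_c w) = grig_d w" "grig_c (grig_d w) = grig_b w" "grig_d (grig_b w) = grig_c w" for w
    by (induction w and w and w rule: grig_b_grig_c_grig_d.induct)
       (auto simp: grig_a_involution)
  have 1: "grig_b \<circ> grig_c = grig_d" "grig_c \<circ> grig_d = grig_b" "grig_d \<circ> grig_b = grig_c"
    by (auto simp: * fun_eq_iff)
  have 2: "grig_c \<circ> grig_b = grig_d" "grig_d \<circ> grig_c = grig_b" "grig_b \<circ> grig_d = grig_c"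
    using iv_comp[of grig_b grig_c] iv_comp[of grig_c grig_d] iv_comp[of grig_d grig_b]
    by (simp_all add: 1)
  show "grig_b \<circ> grig_c = grig_d" "grig_c \<circ> grig_b = grig_d"
    "grig_b \<circ> grig_d = grig_c" "grig_d \<circ> grig_b = grig_c"
    "grig_c \<circ> grig_d = grig_b" "grig_d \<circ> grig_c = grig_b"
    "grig_b \<circ> (grig_c \<circ> x) = grig_d \<circ> x" "grig_c \<circ> (grig_b \<circ> x) = grig_d \<circ> x"
    "grig_b \<circ> (grig_d \<circ> x) = grig_c \<circ> x" "grig_d \<circ> (grig_b \<circ> x) = grig_c \<circ> x"
    "grig_c \<circ> (grig_d \<circ> x) = grig_b \<circ> x" "grig_d \<circ> (grig_c \<circ> x) = grig_b \<circ> x"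
    by (simp_all add: 1 2 flip: comp_assoc)
qed

lemma grig_cases:
  assumes "g \<in> Gr"
  obtains (stab) x y where "x \<in> Gr" "y \<in> Gr" "g = pr x y"
    | (swap) x y where "x \<in> Gr" "y \<in> Gr" "g = pr x y \<circ> grig_a"
proof -
  have "\<exists>x \<in> Gr. \<exists>y \<in> Gr. g = pr x y \<or> g = pr x y \<circ> grig_a"
    using assms
  proof (induction rule: grig_induct)
    case id
    show ?case by (metis id_Gr pr_id)
  next
    case (left s g)
    then obtain x y where xy: "x \<in> Gr" "y \<in> Gr" "g = pr x y \<or> g = pr x y \<circ> grig_a"
      by blast
    obtain u v where uv: "u \<in> Gr" "v \<in> Gr" "s = pr u v \<or> s = grig_a"
      using left.hyps(1) bcd_pr gens_Gr id_Gr by (metis insertE singletonD)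
    have "u \<circ> x \<in> Gr" "v \<circ> y \<in> Gr"
      using xy uv by auto
    moreover have "s \<circ> g \<in> {pr (u \<circ> x) (v \<circ> y), pr (u \<circ> x) (v \<circ> y) \<circ> grig_a, pr y x, pr y x \<circ> grig_a}"
      using xy(3) uv(3) by auto
    ultimately show ?case
      using xy by blast
  qed
  then show thesis using stab swap by blast
qed

lemma pr_Gr_D:
  assumes "pr x y \<in> Gr"
  shows "x \<in> Gr" "y \<in> Gr"
  using assms by (cases rule: grig_cases; simp)+

lemma pr_swap_Gr: "pr x y \<in> Gr \<Longrightarrow> pr y x \<in> Gr"
proof -
  assume "pr x y \<in> Gr"
  then have "grig_a \<circ> pr x y \<circ> grig_a \<in> Gr"
    by (intro comp_Gr gens_Gr)
  then show ?thesis by (simp add: comp_assoc)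
qed

lemma pr_comp_a_Gr: "pr x y \<circ> grig_a \<in> Gr \<longleftrightarrow> pr x y \<in> Gr"
  using comp_Gr[of "pr x y \<circ> grig_a" grig_a] by (auto simp add: comp_assoc)

lemma iv_pr [simp]:
  assumes "pr x y \<in> Gr"
  shows "iv (pr x y) = pr (iv x) (iv y)"
proof -
  have xy: "x \<in> Gr" "y \<in> Gr" using pr_Gr_D[OF assms] by auto
  have "iv (pr x y) \<in> Gr" using assms by simp
  then show ?thesis
  proof (cases rule: grig_cases)
    case (stab x' y')
    have "x' \<circ> x = id \<and> y' \<circ> y = id"
      using iv_cancel(1)[OF assms] by (simp add: stab)
    then show ?thesis using stab xy by (metis iv_unique)
  next
    case (swap x' y')
    have "pr (x' \<circ> y) (y' \<circ> x) \<circ> grig_a = pr id id"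
      using iv_cancel(1)[OF assms] by (simp add: swap comp_assoc)
    then show ?thesis using pr_neq_a by metis
  qed
qed

lemma pr_comp_Gr: "pr x y \<in> Gr \<Longrightarrow> pr x' y' \<in> Gr \<Longrightarrow> pr (x \<circ> x') (y \<circ> y') \<in> Gr"
  using comp_Gr[of "pr x y" "pr x' y'"] by simp

lemma comp_a_cancel [simp]: "f \<circ> grig_a = g \<circ> grig_a \<longleftrightarrow> f = g"
proof
  assume "f \<circ> grig_a = g \<circ> grig_a"
  then have "(f \<circ> grig_a) \<circ> grig_a = (g \<circ> grig_a) \<circ> grig_a" by simp
  then show "f = g" by (simp add: comp_assoc)
qed simp

lemma pr_iv_Gr: "pr x y \<in> Gr \<Longrightarrow> pr (iv x) (iv y) \<in> Gr"
  using grig.inv_closed[of "pr x y"] by simp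

text \<open>The second sections of \<open>b\<close>, \<open>c\<close>, \<open>d\<close> and of the conjugate \<open>pr c a\<close> of \<open>b\<close> are \<open>c\<close>, \<open>d\<close>, \<open>b\<close>
  and \<open>a\<close>.\<close>

lemma right_section_surj:
  assumes "y \<in> Gr" shows "\<exists>x. pr x y \<in> Gr"
  using assms
proof (induction rule: grig_induct)
  case id
  show ?case by (metis id_Gr pr_id)
next
  case (left s g)
  then obtain x where "pr x g \<in> Gr" by blast
  moreover have "\<exists>u. pr u s \<in> Gr"
    using left.hyps(1) gens_Gr pr_swap_Gr[of grig_a grig_c] bcd_pr by (metis insertE singletonD)
  ultimately show ?case using pr_comp_Gr by blast
qed

lemma left_section_surj: "x \<in> Gr \<Longrightarrow> \<exists>y. pr x y \<in> Gr"
  using right_section_surj pr_swap_Gr by blast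

lemma normal_conj:
  assumes "N \<lhd> grigorchuk_group" "n \<in> N" "g \<in> Gr"
  shows "g \<circ> n \<circ> iv g \<in> N" "iv g \<circ> n \<circ> g \<in> N"
  using grig.normal_conj_closed[OF assms] assms normal_imp_subgroup subgroup.mem_carrier
  by (fastforce)+

lemma subgroup_closed:
  assumes "subgroup N grigorchuk_group"
  shows "id \<in> N" "x \<in> N \<Longrightarrow> y \<in> N \<Longrightarrow> x \<circ> y \<in> N" "x \<in> N \<Longrightarrow> iv x \<in> N" "x \<in> N \<Longrightarrow> x \<in> Gr"
proof -
  interpret subgroup N grigorchuk_group by fact
  show "id \<in> N" using one_closed by simp
  show "x \<in> N \<Longrightarrow> y \<in> N \<Longrightarrow> x \<circ> y \<in> N" using m_closed[of x y] by simp
  show "x \<in> N \<Longrightarrow> iv x \<in> N" by simp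
  show "x \<in> N \<Longrightarrow> x \<in> Gr" by simp
qed

lemma normal_grigI:
  assumes "N \<subseteq> Gr" "id \<in> N" "\<And>x y. x \<in> N \<Longrightarrow> y \<in> N \<Longrightarrow> x \<circ> y \<in> N" "\<And>x. x \<in> N \<Longrightarrow> iv x \<in> N"
    and "\<And>x g. x \<in> N \<Longrightarrow> g \<in> Gr \<Longrightarrow> g \<circ> x \<circ> iv g \<in> N"
  shows "N \<lhd> grigorchuk_group"
proof (rule grig.normal_invI)
  show "subgroup N grigorchuk_group"
    using assms(1-4) by unfold_locales (auto simp: subset_iff)
  show "g \<otimes>\<^bsub>grigorchuk_group\<^esub> x \<otimes>\<^bsub>grigorchuk_group\<^esub> iv g \<in> N" if "g \<in> Gr" "x \<in> N" for g x
    using assms that by (simp add: subset_iff)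
qed

section \<open>Pairs over large normal subgroups\<close>

definition pairs :: "(bool list \<Rightarrow> bool list) set \<Rightarrow> (bool list \<Rightarrow> bool list) set" where
  "pairs N = {g \<in> Gr. \<exists>x \<in> N. \<exists>y \<in> N. g = pr x y}"

lemma pr_pairs_iff [simp]: "pr x y \<in> pairs N \<longleftrightarrow> pr x y \<in> Gr \<and> x \<in> N \<and> y \<in> N"
  by (auto simp: pairs_def)

lemma normal_pairsI:
  assumes sub: "\<And>g. g \<in> S \<Longrightarrow> g \<in> Gr \<and> (\<exists>x y. g = pr x y)"
    and "id \<in> S"
    and mult: "\<And>x y x' y'. pr x y \<in> S \<Longrightarrow> pr x' y' \<in> S \<Longrightarrow> pr (x \<circ> x') (y \<circ> y') \<in> S"
    and inv: "\<And>x y. pr x y \<in> S \<Longrightarrow> pr (iv x) (iv y) \<in> S"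
    and conj: "\<And>x y u v. pr x y \<in> S \<Longrightarrow> pr u v \<in> Gr \<Longrightarrow> pr (u \<circ> x \<circ> iv u) (v \<circ> y \<circ> iv v) \<in> S"
    and swap: "\<And>x y. pr x y \<in> S \<Longrightarrow> pr y x \<in> S"
  shows "S \<lhd> grigorchuk_group"
proof (rule normal_grigI)
  show "S \<subseteq> Gr" "id \<in> S" using assms by auto
  show "g \<circ> h \<in> S" if "g \<in> S" "h \<in> S" for g h
    using that sub[OF that(1)] sub[OF that(2)] mult by auto
  show "iv g \<in> S" if "g \<in> S" for g
    using that sub[OF that] inv by auto
  show "g \<circ> n \<circ> iv g \<in> S" if n: "n \<in> S" and g: "g \<in> Gr" for n g
  proof -
    obtain x y where n': "n = pr x y" and nG: "n \<in> Gr" using sub[OF n] by blast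
    from g show ?thesis
    proof (cases rule: grig_cases)
      case (stab u v)
      then show ?thesis using conj[of x y u v] n n' g by simp
    next
      case (swap u v)
      have uv: "pr u v \<in> Gr" using g swap pr_comp_a_Gr by simp
      have "g \<circ> n \<circ> iv g = pr u v \<circ> pr y x \<circ> iv (pr u v)"
        using uv by (simp add: swap n' comp_assoc del: iv_pr)
      then show ?thesis using conj[of y x u v] assms(6)[of x y] n n' uv by simp
    qed
  qed
qed

lemma pairs_normal:
  assumes "N \<lhd> grigorchuk_group"
  shows "pairs N \<lhd> grigorchuk_group"
proof -
  interpret normal N grigorchuk_group by fact
  note cl = subgroup_closed[OF subgroup_axioms]
  show ?thesis
  proof (rule normal_pairsI)
    show "id \<in> pairs N"
      using cl pr_pairs_iff[of id id N] by simp
    show "pr (u \<circ> x \<circ> iv u) (v \<circ> y \<circ> iv v) \<in> pairs N" if "pr x y \<in> pairs N" "pr u v \<in> Gr" for x y u v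
      using that normal_conj(1)[OF assms] pr_Gr_D[OF that(2)]
      by (simp add: pr_comp_Gr pr_iv_Gr)
  qed (use cl in \<open>auto simp: pr_comp_Gr pr_iv_Gr pr_swap_Gr\<close>, auto simp: pairs_def)
qed

text \<open>The two cases are those of \<open>g\<close> fixing and exchanging the two subtrees.\<close>

lemma comm_pr_cases:
  assumes xy: "pr x y \<in> Gr" and g: "g \<in> Gr"
  obtains u v where "u \<in> Gr" "v \<in> Gr" "comm (pr x y) g = pr (comm x u) (comm y v)"
  | u v where "u \<in> Gr" "v \<in> Gr"
     "comm (pr x y) g = pr (x \<circ> (u \<circ> iv y \<circ> iv u)) (y \<circ> (v \<circ> iv x \<circ> iv v))"
proof -
  note D = pr_Gr_D[OF xy]
  from g show thesis
  proof (cases rule: grig_cases)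
    case (stab u v)
    have "comm (pr x y) g = pr (comm x u) (comm y v)"
      using xy g stab D by (simp add: comm_eq)
    then show thesis using that stab by blast
  next
    case (swap u v)
    have uv: "pr u v \<in> Gr" using g swap pr_comp_a_Gr by simp
    have "comm (pr x y) g = pr (x \<circ> (u \<circ> iv y \<circ> iv u)) (y \<circ> (v \<circ> iv x \<circ> iv v))"
      using xy g D uv by (simp add: comm_eq swap comp_assoc pr_swap_Gr)
    then show thesis using that swap by blast
  qed
qed

text \<open>Each step \<open>N > M\<close> of a central series yields two steps for the pairs: from pairs over \<open>N\<close> to those
  whose product \<open>x y\<close> lies in \<open>M\<close>, and from these to the pairs over \<open>M\<close>.\<close>

lemma large_pairs:
  assumes "large grigorchuk_group N"
  shows "large grigorchuk_group (pairs N)"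
  using assms
proof induction
  case large_carrier
  show ?case
  proof (rule large_refine[OF large.large_carrier])
    show "pairs Gr \<lhd> grigorchuk_group"
      by (intro pairs_normal grig.normal_self)
    show "pairs Gr \<subseteq> Gr" by (auto simp: pairs_def)
    have *: "pr x y \<in> pairs Gr" if "pr x y \<in> Gr" for x y
      using pr_Gr_D[OF that] that by simp
    show sq: "g \<otimes>\<^bsub>grigorchuk_group\<^esub> g \<in> pairs Gr" if "g \<in> Gr" for g
    proof -
      have "g \<circ> g \<in> Gr" using that by simp
      then show ?thesis
        using that by (cases rule: grig_cases[OF that]) (auto simp: comp_assoc)
    qed
    show "comm n g \<in> pairs Gr" if "n \<in> Gr" "g \<in> Gr" for n g
    proof -
      interpret P: normal "pairs Gr" grigorchuk_group
        by (intro pairs_normal grig.normal_self)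
      have s: "h \<circ> h \<in> pairs Gr" if "h \<in> Gr" for h using sq[OF that] that by simp
      \<comment> \<open>A commutator is a product of squares.\<close>
      have "(n \<circ> g) \<circ> (n \<circ> g) \<circ> (iv g \<circ> (iv n \<circ> iv n) \<circ> g) \<circ> (iv g \<circ> iv g) \<in> pairs Gr"
        using s[of "n \<circ> g"] s[of "iv g"] normal_conj(2)[OF P.normal_axioms s[of "iv n"], of g] that
        by (metis comp_Gr grig.inv_closed subgroup_closed(2)[OF P.subgroup_axioms])
      moreover have "(n \<circ> g) \<circ> (n \<circ> g) \<circ> (iv g \<circ> (iv n \<circ> iv n) \<circ> g) \<circ> (iv g \<circ> iv g) = comm n g"
        using that by (simp add: comp_assoc comm_eq)
      ultimately show ?thesis by simp
    qed
  qed
next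
  case (large_mono N M)
  show ?case
    by (rule large.large_mono[OF large_mono.IH pairs_normal[OF large_mono.hyps(2)]])
       (use large_mono.hyps(3) in \<open>auto simp: pairs_def\<close>)
next
  case (large_refine N M)
  have N: "N \<lhd> grigorchuk_group" by (rule grig.large_normal) fact
  note M = large_refine.hyps(2)
  interpret M: normal M grigorchuk_group by fact
  interpret N: normal N grigorchuk_group by fact
  note clM = subgroup_closed[OF M.subgroup_axioms] and clN = subgroup_closed[OF N.subgroup_axioms]
  note ctx = M N large_refine.hyps(3-5)
  have sq: "n \<circ> n \<in> M" if "n \<in> N" for n
    using large_refine.hyps(5)[OF that] clN(4)[OF that] by simp
  define D where "D = {g \<in> pairs N. \<exists>x y. g = pr x y \<and> x \<circ> y \<in> M}"
  have D_iff: "pr x y \<in> D \<longleftrightarrow> pr x y \<in> Gr \<and> x \<in> N \<and> y \<in> N \<and> x \<circ> y \<in> M" for x y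
    by (auto simp: D_def)
  have D_normal: "D \<lhd> grigorchuk_group"
  proof (rule normal_pairsI)
    show "g \<in> Gr \<and> (\<exists>x y. g = pr x y)" if "g \<in> D" for g
      using that by (auto simp: D_def)
    show "id \<in> D" using D_iff[of id id] clM(1) clN(1) by simp
    show "pr (x \<circ> x') (y \<circ> y') \<in> D" if "pr x y \<in> D" "pr x' y' \<in> D" for x y x' y'
      using that grig.central_prod_mult[OF ctx, of x y x' y'] clN
      by (auto simp: D_iff pr_comp_Gr)
    show "pr (iv x) (iv y) \<in> D" if "pr x y \<in> D" for x y
      using that grig.central_prod_inv[OF ctx, of x y] clN
      by (auto simp: D_iff pr_iv_Gr)
    show "pr (u \<circ> x \<circ> iv u) (v \<circ> y \<circ> iv v) \<in> D" if "pr x y \<in> D" "pr u v \<in> Gr" for x y u v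
      using that grig.central_prod_conj[OF ctx, of x y u v] clN pr_Gr_D[OF that(2)] normal_conj(1)[OF N]
      by (auto simp: D_iff pr_iv_Gr pr_comp_Gr)
    show "pr y x \<in> D" if "pr x y \<in> D" for x y
      using that grig.central_prod_commute[OF ctx, of x y] clN
      by (auto simp: D_iff pr_swap_Gr)
  qed
  have lD: "large grigorchuk_group D"
  proof (rule large.large_refine[OF large_refine.IH D_normal])
    show "D \<subseteq> pairs N" by (auto simp: D_def)
    show "comm n g \<in> D" if n: "n \<in> pairs N" and g: "g \<in> Gr" for n g
    proof -
      obtain x y where xy: "n = pr x y" "pr x y \<in> Gr" "x \<in> N" "y \<in> N"
        using n by (auto simp: pairs_def)
      have inG: "comm n g \<in> Gr" using xy g by simp
      from xy(2) g show ?thesis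
      proof (cases rule: comm_pr_cases)
        case (1 u v)
        then have "comm x u \<in> M" "comm y v \<in> M"
          using large_refine.hyps(4) xy by auto
        then show ?thesis
          using 1 inG xy(1) clM large_refine.hyps(3) by (auto simp: D_iff)
      next
        case (2 u v)
        then show ?thesis
          using inG xy grig.central_twist[OF ctx, of x y u v] clN normal_conj(1)[OF N]
          by (auto simp: D_iff)
      qed
    qed
    show "n \<otimes>\<^bsub>grigorchuk_group\<^esub> n \<in> D" if n: "n \<in> pairs N" for n
    proof -
      obtain x y where xy: "n = pr x y" "pr x y \<in> Gr" "x \<in> N" "y \<in> N"
        using n by (auto simp: pairs_def)
      then show ?thesis
        using sq clN clM by (auto simp: D_iff pr_comp_Gr)
    qed
  qed
  show ?case
  proof (rule large.large_refine[OF lD pairs_normal[OF M]])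
    show "pairs M \<subseteq> D"
    proof
      fix g assume "g \<in> pairs M"
      then obtain x y where xy: "g = pr x y" "pr x y \<in> Gr" "x \<in> M" "y \<in> M"
        unfolding pairs_def by blast
      then show "g \<in> D"
        unfolding xy(1) D_iff using large_refine.hyps(3) clM(2)[OF xy(3,4)] by blast
    qed
    show "comm n g \<in> pairs M" if n: "n \<in> D" and g: "g \<in> Gr" for n g
    proof -
      obtain x y where xy: "n = pr x y" "pr x y \<in> Gr" "x \<in> N" "y \<in> N" "x \<circ> y \<in> M"
        using n by (auto simp: D_def)
      have yx: "y \<circ> x \<in> M"
        using grig.central_prod_commute[OF ctx, of x y] xy clN by simp
      have inG: "comm n g \<in> Gr" using xy g by simp
      from xy(2) g show ?thesis
      proof (cases rule: comm_pr_cases)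
        case (1 u v)
        then show ?thesis
          using inG large_refine.hyps(4) xy by simp
      next
        case (2 u v)
        then show ?thesis
          using inG xy yx grig.central_twist_prod[OF ctx, of x y u]
            grig.central_twist_prod[OF ctx, of y x v] clN
          by auto
      qed
    qed
    show "n \<otimes>\<^bsub>grigorchuk_group\<^esub> n \<in> pairs M" if n: "n \<in> D" for n
    proof -
      obtain x y where xy: "n = pr x y" "pr x y \<in> Gr" "x \<in> N" "y \<in> N"
        using n by (auto simp: D_def)
      then show ?thesis
        using sq clN clM by (auto simp: pr_comp_Gr)
    qed
  qed
qed

section \<open>The branching subgroup and normal subgroups\<close>

definition corner :: "(bool list \<Rightarrow> bool list) set \<Rightarrow> (bool list \<Rightarrow> bool list) set" where
  "corner H = {x \<in> Gr. pr x id \<in> H}"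

lemma normal_pr_swap:
  assumes "N \<lhd> grigorchuk_group" "pr x y \<in> N"
  shows "pr y x \<in> N"
proof -
  have "grig_a \<circ> pr x y \<circ> iv grig_a \<in> N"
    using assms by (intro normal_conj) auto
  then show ?thesis by (simp add: comp_assoc)
qed

text \<open>Conjugation of \<open>pr x 1\<close> by \<open>pr g h\<close> changes only the first section, and conjugates it by \<open>g\<close>.\<close>

lemma corner_normalI:
  assumes H: "subgroup H grigorchuk_group"
    and conj: "\<And>g. g \<in> Gr \<Longrightarrow> \<exists>h. pr g h \<in> Gr \<and> (\<forall>x \<in> H. pr g h \<circ> x \<circ> iv (pr g h) \<in> H)"
  shows "corner H \<lhd> grigorchuk_group"
proof (rule normal_grigI)
  note cl = subgroup_closed[OF H]
  show "id \<in> corner H" by (simp add: corner_def cl(1))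
  show "x \<circ> y \<in> corner H" if "x \<in> corner H" "y \<in> corner H" for x y
    using that cl(2)[of "pr x id" "pr y id"] by (simp add: corner_def)
  show "iv x \<in> corner H" if "x \<in> corner H" for x
    using that cl(3)[of "pr x id"] cl(4)[of "pr x id"] by (simp add: corner_def)
  show "g \<circ> x \<circ> iv g \<in> corner H" if x: "x \<in> corner H" and g: "g \<in> Gr" for x g
  proof -
    obtain h where h: "pr g h \<in> Gr" "\<forall>x \<in> H. pr g h \<circ> x \<circ> iv (pr g h) \<in> H"
      using conj[OF g] by blast
    then have "pr g h \<circ> pr x id \<circ> iv (pr g h) \<in> H"
      using x by (simp add: corner_def del: iv_pr pr_comp)
    then show ?thesis
      using x g h(1) pr_Gr_D[OF h(1)] by (simp add: corner_def)
  qed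
qed (auto simp: corner_def)

lemma corner_normal:
  assumes N: "N \<lhd> grigorchuk_group"
  shows "corner N \<lhd> grigorchuk_group"
proof (rule corner_normalI[OF normal_imp_subgroup[OF N]])
  fix g assume "g \<in> Gr"
  then obtain h where "pr g h \<in> Gr" using left_section_surj by blast
  then show "\<exists>h. pr g h \<in> Gr \<and> (\<forall>x \<in> N. pr g h \<circ> x \<circ> iv (pr g h) \<in> N)"
    using normal_conj(1)[OF N] by blast
qed

lemma pairs_corner_subset:
  assumes H: "subgroup H grigorchuk_group" and swap: "\<And>x. pr x id \<in> H \<Longrightarrow> pr id x \<in> H"
  shows "pairs (corner H) \<subseteq> H"
proof
  fix g assume "g \<in> pairs (corner H)"
  then obtain x y where "g = pr x y" "pr x id \<in> H" "pr y id \<in> H"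
    by (auto simp: pairs_def corner_def)
  then show "g \<in> H"
    using subgroup_closed(2)[OF H, of "pr x id" "pr id y"] swap by simp
qed

text \<open>\<open>N\<close> contains all pairs over its corner.\<close>

lemma large_if_corner_large:
  assumes N: "N \<lhd> grigorchuk_group" and "large grigorchuk_group (corner N)"
  shows "large grigorchuk_group N"
  using large.large_mono[OF large_pairs[OF assms(2)] N]
    pairs_corner_subset[OF normal_imp_subgroup[OF N]] normal_pr_swap[OF N] by blast

definition grig_t :: "bool list \<Rightarrow> bool list" where
  "grig_t = grig_a \<circ> grig_b \<circ> grig_a \<circ> grig_b"

text \<open>The normal closure of \<open>t = (ab)\<^sup>2\<close>.\<close>

definition grig_K :: "(bool list \<Rightarrow> bool list) set" where
  "grig_K = generate grigorchuk_group {g \<circ> grig_t \<circ> iv g | g. g \<in> Gr}"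

lemma t_Gr [simp]: "grig_t \<in> Gr" by (simp add: grig_t_def)

lemma t_pr: "grig_t = pr (grig_c \<circ> grig_a) (grig_a \<circ> grig_c)"
  by (simp add: grig_t_def bcd_pr(1) comp_assoc)

lemma K_normal: "grig_K \<lhd> grigorchuk_group"
  unfolding grig_K_def
proof (rule grig.normal_generateI)
  fix h g assume "h \<in> {g \<circ> grig_t \<circ> iv g |g. g \<in> Gr}" and g: "g \<in> Gr"
  then obtain g' where g': "h = g' \<circ> grig_t \<circ> iv g'" "g' \<in> Gr" by blast
  then have "g \<otimes>\<^bsub>grigorchuk_group\<^esub> h \<otimes>\<^bsub>grigorchuk_group\<^esub> iv g = (g \<circ> g') \<circ> grig_t \<circ> iv (g \<circ> g')"
    using g by (simp add: comp_assoc)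
  then show "g \<otimes>\<^bsub>grigorchuk_group\<^esub> h \<otimes>\<^bsub>grigorchuk_group\<^esub> iv g \<in> {g \<circ> grig_t \<circ> iv g |g. g \<in> Gr}"
    using g g' comp_Gr by blast
qed auto

lemmas K_closed = subgroup_closed[OF normal_imp_subgroup[OF K_normal]]

lemma t_K: "grig_t \<in> grig_K"
proof -
  have "grig_t = id \<circ> grig_t \<circ> iv id" using iv_unique[of id id] by simp
  then show ?thesis unfolding grig_K_def using id_Gr by (intro generate.incl) blast
qed

lemma K_least:
  assumes "N \<lhd> grigorchuk_group" "grig_t \<in> N"
  shows "grig_K \<subseteq> N"
  unfolding grig_K_def
  using assms normal_conj(1)[OF assms] by (intro grig.generate_subgroup_incl normal_imp_subgroup) auto

text \<open>With \<open>t = pr (c a) (a c)\<close> and \<open>d = pr 1 b\<close> the second section is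
  \<open>a (c b c) a b = (ab)\<^sup>2\<close>. This makes the group a branch group.\<close>

lemma comm_t_d: "comm grig_t grig_d = pr id grig_t"
proof -
  have "comm grig_t grig_d = grig_t \<circ> grig_d \<circ> iv grig_t \<circ> grig_d"
    by (simp add: comm_eq)
  also have "iv grig_t = pr (grig_a \<circ> grig_c) (grig_c \<circ> grig_a)"
    by (rule iv_unique) (use t_Gr iv_pr[of "grig_c \<circ> grig_a" "grig_a \<circ> grig_c"] grig.inv_closed[OF t_Gr]
        in \<open>auto simp: t_pr comp_assoc\<close>)
  also have "grig_t \<circ> grig_d \<circ> pr (grig_a \<circ> grig_c) (grig_c \<circ> grig_a) \<circ> grig_d
      = pr id (grig_a \<circ> grig_b \<circ> grig_a \<circ> grig_b)"
    unfolding t_pr bcd_pr(3) by (simp add: comp_assoc)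
  finally show ?thesis unfolding grig_t_def .
qed

text \<open>By \<open>comm_t_d\<close> the element \<open>t\<close> lies in the corner of \<open>K\<close>, which is normal.\<close>

lemma K_pairs:
  assumes "k \<in> grig_K"
  shows "pr k id \<in> grig_K" "pr id k \<in> grig_K"
proof -
  have "pr id grig_t \<in> grig_K"
    using grig.commutator_in_normal[OF K_normal t_K, of grig_d] comm_t_d by simp
  then have "grig_t \<in> corner grig_K"
    using normal_pr_swap[OF K_normal] by (simp add: corner_def)
  then show *: "pr k id \<in> grig_K"
    using K_least[OF corner_normal[OF K_normal]] assms by (auto simp: corner_def)
  then show "pr id k \<in> grig_K"
    by (rule normal_pr_swap[OF K_normal])
qed

text \<open>The generators \<open>b\<close>, \<open>c\<close>, \<open>d\<close> commute. The commutators of \<open>a\<close> with \<open>b\<close>, \<open>c\<close>, \<open>d\<close> are \<open>t\<close>,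
  an element of \<open>K u\<close> and \<open>u = pr b b\<close>, and \<open>u\<close> is an involution that is central modulo \<open>K\<close>.\<close>

lemma K_large: "large grigorchuk_group grig_K"
proof (rule grig.large_if_central_mod_generators[OF K_normal _ generate_grig])
  let ?u = "pr grig_b grig_b"
  let ?Z = "grig.central_mod grig_K"
  note Z = grig.central_mod_normal[OF K_normal]
  note KZ = subsetD[OF grig.central_mod_superset[OF K_normal]]
  note clZ = subgroup_closed[OF normal_imp_subgroup[OF Z]]
  have u: "comm grig_a grig_d = ?u"
    by (simp add: comm_eq) (simp add: bcd_pr(3) comp_assoc)
  then have uG: "?u \<in> Gr" by (metis gens_Gr grig.commutator_closed)
  have ivu: "iv ?u = ?u" using uG by simp
  have baba: "grig_b \<circ> (grig_a \<circ> (grig_b \<circ> grig_a)) \<in> grig_K"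
    using K_closed(3)[OF t_K] by (simp add: grig_t_def comp_assoc)
  have uZ: "?u \<in> ?Z"
  proof -
    have "comm ?u s \<in> grig_K" if "s \<in> {grig_a, grig_b, grig_c, grig_d}" for s
    proof -
      have "comm ?u grig_a = id"
        using uG by (simp add: comm_eq ivu comp_assoc del: iv_pr)
      moreover have "comm ?u s = pr (grig_b \<circ> (p \<circ> (grig_b \<circ> p))) (grig_b \<circ> (q \<circ> (grig_b \<circ> q)))"
        if s: "s = pr p q" "iv s = s" "s \<in> Gr" for s p q
      proof -
        have "comm ?u s = ?u \<circ> s \<circ> ?u \<circ> s"
          using uG s(2,3) by (simp add: comm_eq ivu del: iv_pr)
        then show ?thesis by (simp add: s(1) comp_assoc)
      qed
      from this[OF bcd_pr(1)] this[OF bcd_pr(2)] this[OF bcd_pr(3)]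
      have "comm ?u grig_b = pr (grig_b \<circ> (grig_a \<circ> (grig_b \<circ> grig_a))) id"
        "comm ?u grig_c = pr (grig_b \<circ> (grig_a \<circ> (grig_b \<circ> grig_a))) id"
        "comm ?u grig_d = id"
        by simp_all
      ultimately show ?thesis using that K_closed(1) K_pairs(1)[OF baba] by auto
    qed
    then have "comm ?u g \<in> grig_K" if "g \<in> Gr" for g
      using grig.commutator_generators[OF K_normal _ generate_grig uG] that by auto
    then show ?thesis
      using uG K_closed(1) by (simp add: grig.central_mod_def)
  qed
  have ac: "comm grig_a grig_c \<in> ?Z"
  proof -
    have "pr (grig_d \<circ> grig_t \<circ> iv grig_d) id \<circ> grig_t \<circ> ?u \<in> ?Z"
      by (rule clZ(2)[OF clZ(2)[OF KZ[OF K_pairs(1)[OF normal_conj(1)[OF K_normal t_K gens_Gr(4)]]] KZ[OF t_K]] uZ])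
    moreover have "grig_d \<circ> grig_t \<circ> iv grig_d = grig_d \<circ> (grig_a \<circ> (grig_b \<circ> (grig_a \<circ> grig_c)))"
      by (simp add: grig_t_def comp_assoc)
    then have "pr (grig_d \<circ> grig_t \<circ> iv grig_d) id \<circ> grig_t \<circ> ?u = pr (grig_d \<circ> grig_a) (grig_a \<circ> grig_d)"
      by (simp add: t_pr comp_assoc)
    moreover have "comm grig_a grig_c = pr (grig_d \<circ> grig_a) (grig_a \<circ> grig_d)"
      by (simp add: comm_eq comp_assoc) (simp add: bcd_pr(2) comp_assoc)
    ultimately show ?thesis by simp
  qed
  have ab: "comm grig_a grig_b \<in> ?Z"
    using KZ[OF t_K] by (simp add: comm_eq grig_t_def)
  have triv: "comm s s' = id" if "s \<in> {grig_b, grig_c, grig_d}" "s' \<in> {grig_b, grig_c, grig_d}" for s s'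
    using that by (auto simp: comm_eq comp_assoc)
  have aa: "comm grig_a grig_a = id" by (simp add: comm_eq comp_assoc)
  note swap = grig.commutator_swap[OF Z]
  show "comm s s' \<in> ?Z" if "s \<in> {grig_a, grig_b, grig_c, grig_d}" "s' \<in> {grig_a, grig_b, grig_c, grig_d}" for s s'
    using that aa triv[of s s'] ab ac uZ u clZ(1) swap[of grig_a grig_b] swap[of grig_a grig_c]
      swap[of grig_a grig_d] by auto
  show "s \<otimes>\<^bsub>grigorchuk_group\<^esub> s \<in> ?Z" if "s \<in> {grig_a, grig_b, grig_c, grig_d}" for s
    using that clZ(1) by auto
qed auto

lemma comm_corner_stab:
  assumes k: "k \<in> grig_K" and f: "pr f0 f1 \<in> Gr"
  shows "comm (pr k id) (pr f0 f1) = pr (comm k f0) id" "comm (pr id k) (pr f0 f1) = pr id (comm k f1)"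
  using K_closed(4)[OF k] K_closed(4)[OF K_pairs(1)[OF k]] K_closed(4)[OF K_pairs(2)[OF k]] f pr_Gr_D[OF f]
  by (simp_all add: comm_eq)

lemma comm_corner_swap:
  assumes k: "k \<in> grig_K" and f: "pr u w \<in> Gr"
  shows "comm (pr k id) (pr u w \<circ> grig_a) = pr k (w \<circ> (iv k \<circ> iv w))"
  using K_closed(4)[OF k] K_closed(4)[OF K_pairs(1)[OF k]] f pr_Gr_D[OF f]
  by (simp add: comm_eq comp_assoc)

text \<open>Equivalently, the subgroup \<open>[K, f]\<close> is contained in no normal subgroup but large ones. The aim is
  to reach \<open>f = t\<close>, which shows that the commutator subgroup of \<open>K\<close> is large.\<close>

definition K_comm_large :: "(bool list \<Rightarrow> bool list) \<Rightarrow> bool" where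
  "K_comm_large f \<longleftrightarrow> (\<forall>N. N \<lhd> grigorchuk_group \<longrightarrow> (\<forall>k \<in> grig_K. comm k f \<in> N) \<longrightarrow> large grigorchuk_group N)"

text \<open>The commutators of \<open>f\<close> with \<open>pr k 1\<close> and \<open>pr 1 k\<close> are concentrated in one subtree, where they
  are the commutators of \<open>k\<close> with a section of \<open>f\<close>.\<close>

lemma K_comm_large_sections:
  assumes f: "pr f0 f1 \<in> Gr" and s: "K_comm_large f0 \<or> K_comm_large f1"
  shows "K_comm_large (pr f0 f1)"
  unfolding K_comm_large_def
proof (intro allI impI)
  fix N assume N: "N \<lhd> grigorchuk_group" and *: "\<forall>k\<in>grig_K. comm k (pr f0 f1) \<in> N"
  note D = pr_Gr_D[OF f]
  have "comm k f0 \<in> corner N \<and> comm k f1 \<in> corner N" if k: "k \<in> grig_K" for k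
  proof -
    have "pr (comm k f0) id \<in> N" "pr id (comm k f1) \<in> N"
      using * K_pairs[OF k] comm_corner_stab[OF k f] by metis+
    then show ?thesis
      using K_closed(4)[OF k] D normal_pr_swap[OF N] by (simp add: corner_def)
  qed
  then have "large grigorchuk_group (corner N)"
    using s corner_normal[OF N] unfolding K_comm_large_def by blast
  then show "large grigorchuk_group N"
    by (rule large_if_corner_large[OF N])
qed

text \<open>\<open>[k, f\<^sup>2]\<close> is the product of \<open>[k, f]\<close> and a conjugate of it.\<close>

lemma K_comm_large_square:
  assumes f: "f \<in> Gr" and s: "K_comm_large (f \<circ> f)"
  shows "K_comm_large f"
  unfolding K_comm_large_def
proof (intro allI impI)
  fix N assume N: "N \<lhd> grigorchuk_group" and *: "\<forall>k\<in>grig_K. comm k f \<in> N"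
  have "comm k (f \<circ> f) \<in> N" if k: "k \<in> grig_K" for k
  proof -
    have "comm k f \<circ> (f \<circ> comm k f \<circ> iv f) \<in> N"
      using * k f N by (intro subgroup_closed(2) normal_imp_subgroup normal_conj) auto
    then show ?thesis
      using K_closed(4)[OF k] f by (simp add: comm_eq comp_assoc)
  qed
  then show "large grigorchuk_group N"
    using s N unfolding K_comm_large_def by blast
qed

text \<open>Already \<open>[t, d] = pr 1 t\<close> forces the corner to contain \<open>K\<close>.\<close>

lemma K_comm_large_d: "K_comm_large grig_d"
  unfolding K_comm_large_def
proof (intro allI impI)
  fix N assume N: "N \<lhd> grigorchuk_group" and "\<forall>k\<in>grig_K. comm k grig_d \<in> N"
  then have "pr id grig_t \<in> N" using t_K comm_t_d by metis
  then have "grig_t \<in> corner N" using normal_pr_swap[OF N] by (simp add: corner_def)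
  then have "large grigorchuk_group (corner N)"
    using large.large_mono[OF K_large corner_normal[OF N]] K_least[OF corner_normal[OF N]] by blast
  then show "large grigorchuk_group N"
    by (rule large_if_corner_large[OF N])
qed

text \<open>Climb from sections to elements: \<open>d\<close> is a section of \<open>c\<close>, which is a section of \<open>b\<close>, which is a
  section of \<open>(ad)\<^sup>2\<close>; then \<open>ad\<close> is a section of \<open>(ac)\<^sup>2\<close>, and \<open>ac\<close> of \<open>t\<close>.\<close>

lemma K_comm_large_t: "K_comm_large grig_t"
proof -
  have c: "K_comm_large grig_c"
    using K_comm_large_sections[of grig_a grig_d] K_comm_large_d gens_Gr(3) bcd_pr(2) by metis
  have b: "K_comm_large grig_b"
    using K_comm_large_sections[of grig_a grig_c] c gens_Gr(2) bcd_pr(1) by metis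
  have ad2: "(grig_a \<circ> grig_d) \<circ> (grig_a \<circ> grig_d) = pr grig_b grig_b"
    by (simp add: bcd_pr(3) comp_assoc)
  have "(grig_a \<circ> grig_d) \<circ> (grig_a \<circ> grig_d) \<in> Gr" by (intro comp_Gr gens_Gr)
  then have ad: "K_comm_large (grig_a \<circ> grig_d)"
    using K_comm_large_sections[of grig_b grig_b] b by (intro K_comm_large_square[of "grig_a \<circ> grig_d"]) (simp_all only: ad2 comp_Gr gens_Gr simp_thms)
  have ac2: "(grig_a \<circ> grig_c) \<circ> (grig_a \<circ> grig_c) = pr (grig_d \<circ> grig_a) (grig_a \<circ> grig_d)"
    by (simp add: comp_assoc) (simp add: bcd_pr(2) comp_assoc)
  have "(grig_a \<circ> grig_c) \<circ> (grig_a \<circ> grig_c) \<in> Gr" by (intro comp_Gr gens_Gr)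
  then have ac: "K_comm_large (grig_a \<circ> grig_c)"
    using K_comm_large_sections[of "grig_d \<circ> grig_a" "grig_a \<circ> grig_d"] ad
    by (intro K_comm_large_square[of "grig_a \<circ> grig_c"]) (simp_all only: ac2 comp_Gr gens_Gr simp_thms)
  then show ?thesis
    using K_comm_large_sections[of "grig_c \<circ> grig_a" "grig_a \<circ> grig_c"] t_Gr by (simp add: t_pr)
qed

lemma large_if_K_commutators:
  assumes "N \<lhd> grigorchuk_group" "\<And>k k'. k \<in> grig_K \<Longrightarrow> k' \<in> grig_K \<Longrightarrow> comm k k' \<in> N"
  shows "large grigorchuk_group N"
  using K_comm_large_t assms t_K unfolding K_comm_large_def by blast

lemma Gr_Nil: "f \<in> Gr \<Longrightarrow> f [] = []"
  using Gr_tree_auts by (auto simp: tree_auts_def)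

text \<open>Follow the path to the vertex \<open>v\<close>. While \<open>f\<close> fixes the subtrees, the hypothesis passes to a
  section of \<open>f\<close> and the corner of \<open>N\<close>. Once \<open>f\<close> exchanges them, \<open>[pr k 1, f]\<close> has first
  section \<open>k\<close>, and its commutator with \<open>pr k' 1\<close> is \<open>pr [k, k'] 1\<close>. The hypothesis speaks of
  double commutators because these, unlike membership of \<open>f\<close> in \<open>N\<close>, are inherited by the corner.\<close>

lemma large_if_double_commutators:
  assumes "N \<lhd> grigorchuk_group" "f \<in> Gr" "f v \<noteq> v"
    and "\<And>k k'. k \<in> grig_K \<Longrightarrow> k' \<in> grig_K \<Longrightarrow> comm (comm k f) k' \<in> N"
  shows "large grigorchuk_group N"
  using assms
proof (induction v arbitrary: N f)
  case Nil
  then show ?case using Gr_Nil by simp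
next
  case (Cons x v)
  note N = Cons.prems(1) and f = Cons.prems(2)
  note C = corner_normal[OF N]
  from f show ?case
  proof (cases rule: grig_cases)
    case (stab f0 f1)
    have G: "pr f0 f1 \<in> Gr" using f stab(3) by simp
    have sec: "comm (comm k f0) k' \<in> corner N \<and> comm (comm k f1) k' \<in> corner N"
      if k: "k \<in> grig_K" "k' \<in> grig_K" for k k'
    proof -
      note kG = K_closed(4)[OF k(1)] K_closed(4)[OF k(2)]
        K_closed(4)[OF K_pairs(1)[OF k(1)]] K_closed(4)[OF K_pairs(2)[OF k(1)]]
        K_closed(4)[OF K_pairs(1)[OF k(2)]] K_closed(4)[OF K_pairs(2)[OF k(2)]]
      have 2: "pr (comm k f0) id \<in> Gr" "pr id (comm k f1) \<in> Gr"
        using comm_corner_stab[OF k(1) G] kG G by (metis grig.commutator_closed)+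
      have "comm (comm (pr k id) f) (pr k' id) = pr (comm (comm k f0) k') id"
        "comm (comm (pr id k) f) (pr id k') = pr id (comm (comm k f1) k')"
        unfolding stab(3) comm_corner_stab[OF k(1) G]
        using kG 2 stab by (simp_all add: comm_eq[of "pr _ _"] comm_eq[of "comm _ _" k'])
      then have "pr (comm (comm k f0) k') id \<in> N" "pr id (comm (comm k f1) k') \<in> N"
        using Cons.prems(4) K_pairs k by metis+
      then show ?thesis using kG stab normal_pr_swap[OF N] by (simp add: corner_def)
    qed
    have "f0 v \<noteq> v \<or> f1 v \<noteq> v"
      using Cons.prems(3) stab by (cases x) auto
    then have "large grigorchuk_group (corner N)"
      using Cons.IH[OF C, of f0] Cons.IH[OF C, of f1] sec stab by blast
    then show ?thesis by (rule large_if_corner_large[OF N])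
  next
    case (swap u w)
    have uw: "pr u w \<in> Gr" using f unfolding swap(3) by (rule pr_comp_a_Gr[THEN iffD1])
    have "comm k k' \<in> corner N" if k: "k \<in> grig_K" "k' \<in> grig_K" for k k'
    proof -
      note kG = K_closed(4)[OF k(1)] K_closed(4)[OF k(2)]
        K_closed(4)[OF K_pairs(1)[OF k(1)]] K_closed(4)[OF K_pairs(1)[OF k(2)]]
      note 1 = comm_corner_swap[OF k(1) uw, folded swap(3)]
      have 2: "pr k (w \<circ> (iv k \<circ> iv w)) \<in> Gr"
        using 1 kG f by (metis grig.commutator_closed)
      have "comm (comm (pr k id) f) (pr k' id) = pr (comm k k') id"
        using kG 1 2 swap by (simp add: comm_eq comp_assoc)
      then have "pr (comm k k') id \<in> N"
        using Cons.prems(4) K_pairs k by metis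
      then show ?thesis using kG by (simp add: corner_def)
    qed
    then have "large grigorchuk_group (corner N)"
      by (rule large_if_K_commutators[OF C])
    then show ?thesis by (rule large_if_corner_large[OF N])
  qed
qed

text \<open>A strong form of the fact that the group is just infinite.\<close>

theorem nontrivial_normal_large:
  assumes N: "N \<lhd> grigorchuk_group" and f: "f \<in> N" "f \<noteq> id"
  shows "large grigorchuk_group N"
proof -
  obtain v where v: "f v \<noteq> v" using f(2) by (auto simp: fun_eq_iff)
  have fG: "f \<in> Gr" using subgroup_closed(4)[OF normal_imp_subgroup[OF N] f(1)] .
  have "comm (comm k f) k' \<in> N" if k: "k \<in> grig_K" "k' \<in> grig_K" for k k'
  proof -
    note kG = K_closed(4)[OF k(1)] K_closed(4)[OF k(2)]
    have "comm k f \<in> N"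
      using grig.commutator_swap[OF N, of f k] grig.commutator_in_normal[OF N f(1)] kG fG by simp
    then show ?thesis using grig.commutator_in_normal[OF N] kG by simp
  qed
  then show ?thesis using large_if_double_commutators[OF N fG v] by blast
qed

section \<open>Subgroups whose sections fill the group\<close>

definition level_stab :: "nat \<Rightarrow> (bool list \<Rightarrow> bool list) set" where
  "level_stab n = {g \<in> Gr. \<forall>w. length w = n \<longrightarrow> g w = w}"

lemma length_Gr [simp]: "g \<in> Gr \<Longrightarrow> length (g w) = length w"
proof (induction w arbitrary: g)
  case Nil
  then show ?case by (simp add: Gr_Nil)
next
  case (Cons x w)
  from Cons.prems show ?case
    by (cases rule: grig_cases; cases x) (auto simp: Cons.IH)
qed

lemma level_stab_normal: "level_stab n \<lhd> grigorchuk_group"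
proof (rule normal_grigI)
  have iv: "iv g (g w) = w" "g (iv g w) = w" if "g \<in> Gr" for g w
    using iv_cancel(1,2)[OF that] by (metis comp_apply id_apply)+
  show "iv x \<in> level_stab n" if x: "x \<in> level_stab n" for x
    using x iv[of x] by (auto simp: level_stab_def) metis
  show "g \<circ> x \<circ> iv g \<in> level_stab n" if "x \<in> level_stab n" "g \<in> Gr" for x g
    using that iv[of g] by (auto simp: level_stab_def)
qed (auto simp: level_stab_def)

text \<open>From here on products are kept as compositions and not evaluated at words.\<close>

declare comp_apply [simp del] id_apply [simp del]

definition sections :: "(bool list \<Rightarrow> bool list) set \<Rightarrow> (bool list \<Rightarrow> bool list) set" where
  "sections H = {x. \<exists>y. pr x y \<in> H}"

lemma subgroup_pr_swap:
  assumes H: "subgroup H grigorchuk_group" and "grig_a \<in> H" "pr x y \<in> H"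
  shows "pr y x \<in> H"
proof -
  have "grig_a \<circ> pr x y \<circ> grig_a \<in> H"
    using assms by (intro subgroup_closed(2)[OF H])
  then show ?thesis by (simp add: comp_assoc)
qed

text \<open>The corner of \<open>H\<close> is normalised by the first sections of \<open>H\<close>, so it is a nontrivial normal
  subgroup and therefore large. Thus \<open>H\<close> contains the large subgroup of pairs over it, and a
  subgroup that contains a large one and has full normal closure is everything.\<close>

lemma subgroup_eq_if_sections_full:
  assumes H: "subgroup H grigorchuk_group" and a: "grig_a \<in> H"
    and full: "\<And>M. M \<lhd> grigorchuk_group \<Longrightarrow> H \<subseteq> M \<Longrightarrow> M = Gr"
    and sec: "sections H = Gr" and r: "pr r id \<in> H" "r \<noteq> id"
  shows "H = Gr"
proof -
  note cl = subgroup_closed[OF H]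
  have "corner H \<lhd> grigorchuk_group"
  proof (rule corner_normalI[OF H])
    fix g assume "g \<in> Gr"
    then obtain h where h: "pr g h \<in> H" using sec by (auto simp: sections_def)
    have "pr g h \<circ> x \<circ> iv (pr g h) \<in> H" if "x \<in> H" for x
      by (rule cl(2)[OF cl(2)[OF h that] cl(3)[OF h]])
    then show "\<exists>h. pr g h \<in> Gr \<and> (\<forall>x \<in> H. pr g h \<circ> x \<circ> iv (pr g h) \<in> H)"
      using cl(4)[OF h] by blast
  qed
  moreover have "r \<in> corner H"
    using r pr_Gr_D(1)[OF cl(4)[OF r(1)]] by (simp add: corner_def)
  ultimately have "large grigorchuk_group (pairs (corner H))"
    using nontrivial_normal_large r(2) large_pairs by blast
  then have "H <#>\<^bsub>grigorchuk_group\<^esub> pairs (corner H) = Gr"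
    by (rule grig.supplement_of_large[OF _ H full])
  moreover have "pairs (corner H) \<subseteq> H"
    by (rule pairs_corner_subset[OF H subgroup_pr_swap[OF H a]])
  ultimately have "Gr \<subseteq> H"
    using mono_set_mult[of H H "pairs (corner H)" H grigorchuk_group] grig.subgroup_mult_id[OF H] by auto
  then show ?thesis using cl(4) by blast
qed

section \<open>Conjugates of the letters b, c, d\<close>

text \<open>A letter \<open>s\<close> stands for one of \<open>b\<close>, \<open>c\<close>, \<open>d\<close>. Its first section \<open>lsec s\<close> is \<open>a\<close>, \<open>a\<close>, \<open>1\<close>, and
  its second section is again a letter \<open>rsec s\<close>: the map \<open>rsec\<close> is the cycle \<open>b, c, d\<close>.\<close>

datatype letter = B | C | D

fun ev :: "letter \<Rightarrow> bool list \<Rightarrow> bool list" where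
  "ev B = grig_b" | "ev C = grig_c" | "ev D = grig_d"

fun lsec :: "letter \<Rightarrow> bool list \<Rightarrow> bool list" where
  "lsec B = grig_a" | "lsec C = grig_a" | "lsec D = id"

fun rsec :: "letter \<Rightarrow> letter" where
  "rsec B = C" | "rsec C = D" | "rsec D = B"

text \<open>The word \<open>a s\<^sub>1 a s\<^sub>2 \<dots> a s\<^sub>m\<close>.\<close>

fun word :: "letter list \<Rightarrow> bool list \<Rightarrow> bool list" where
  "word [] = id"
| "word (s # ss) = grig_a \<circ> ev s \<circ> word ss"

text \<open>The two sections of a word, up to their order. They alternate between first and second sections of
  the letters, \<open>secU\<close> beginning with a first and \<open>secV\<close> with a second section.\<close>

fun secU :: "letter list \<Rightarrow> bool list \<Rightarrow> bool list"
  and secV :: "letter list \<Rightarrow> bool list \<Rightarrow> bool list" where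
  "secU [] = id"
| "secU (s # ss) = lsec s \<circ> secV ss"
| "secV [] = id"
| "secV (s # ss) = ev (rsec s) \<circ> secU ss"

definition cj :: "letter \<Rightarrow> (bool list \<Rightarrow> bool list) \<Rightarrow> bool list \<Rightarrow> bool list" where
  "cj s g = iv g \<circ> ev s \<circ> g"

lemma ev_pr: "ev s = pr (lsec s) (ev (rsec s))"
  by (cases s) (simp_all flip: bcd_pr)

lemma ev_Gr [simp]: "ev s \<in> Gr" by (cases s) auto
lemma lsec_Gr [simp]: "lsec s \<in> Gr" by (cases s) auto
lemma word_Gr [simp]: "word ss \<in> Gr" by (induction ss) auto
lemma sec_Gr [simp]: "secU ss \<in> Gr" "secV ss \<in> Gr"
  by (induction ss) auto

lemma ev_invol [simp]: "ev s \<circ> ev s = id" "ev s \<circ> (ev s \<circ> x) = x"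
  by (cases s; simp)+

lemma lsec_invol [simp]: "lsec s \<circ> lsec s = id" "lsec s \<circ> (lsec s \<circ> x) = x"
  by (cases s; simp)+

lemma iv_ev [simp]: "iv (ev s) = ev s" by (simp add: iv_unique)
lemma iv_lsec [simp]: "iv (lsec s) = lsec s" by (simp add: iv_unique)

lemma pr_ev_Gr [simp]: "pr (lsec s) (ev (rsec s)) \<in> Gr" "pr (ev (rsec s)) (lsec s) \<in> Gr"
proof -
  show *: "pr (lsec s) (ev (rsec s)) \<in> Gr"
    using ev_Gr[of s] by (simp flip: ev_pr)
  show "pr (ev (rsec s)) (lsec s) \<in> Gr"
    by (rule pr_swap_Gr[OF *])
qed

text \<open>Each factor \<open>a\<close> exchanges the coordinates and thereby the roles of \<open>secU\<close> and \<open>secV\<close>; which of the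
  two orders results depends on the length of the word.\<close>

lemma conj_word_pr:
  fixes ss
  defines "p x \<equiv> iv (secV ss) \<circ> x \<circ> secV ss" and "q y \<equiv> iv (secU ss) \<circ> y \<circ> secU ss"
  assumes "pr x y \<in> Gr"
  shows "iv (word ss) \<circ> pr x y \<circ> word ss \<in> {pr (p x) (q y), pr (q y) (p x)}"
  using assms(3) unfolding assms(1,2)
proof (induction ss arbitrary: x y)
  case Nil
  then show ?case by simp
next
  case (Cons s ss)
  define x' where "x' = lsec s \<circ> y \<circ> lsec s"
  define y' where "y' = ev (rsec s) \<circ> x \<circ> ev (rsec s)"
  note xy = pr_Gr_D[OF Cons.prems]
  have "ev s \<circ> pr y x \<circ> ev s = pr x' y'"
    unfolding ev_pr[of s] x'_def y'_def by (simp add: comp_assoc)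
  moreover have "ev s \<circ> pr y x \<circ> ev s \<in> Gr"
    using pr_swap_Gr[OF Cons.prems] by simp
  ultimately have G: "pr x' y' \<in> Gr" by simp
  have "iv (word (s # ss)) \<circ> pr x y \<circ> word (s # ss) = iv (word ss) \<circ> (ev s \<circ> pr y x \<circ> ev s) \<circ> word ss"
    by (simp add: comp_assoc)
  also have "\<dots> = iv (word ss) \<circ> pr x' y' \<circ> word ss"
    using \<open>ev s \<circ> pr y x \<circ> ev s = pr x' y'\<close> by simp
  finally have eq: "iv (word (s # ss)) \<circ> pr x y \<circ> word (s # ss) = iv (word ss) \<circ> pr x' y' \<circ> word ss" .
  show ?case
    using Cons.IH[OF G] xy unfolding eq x'_def y'_def by (auto simp: comp_assoc)
qed

text \<open>A conjugate of a letter \<open>s\<close> in \<open>H\<close> gives conjugates of \<open>lsec s\<close> and of \<open>rsec s\<close> as sections.\<close>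

lemma cj_word_pr:
  assumes H: "subgroup H grigorchuk_group" "grig_a \<in> H" and "cj s (word ss) \<in> H"
  shows "pr (iv (secV ss) \<circ> lsec s \<circ> secV ss) (cj (rsec s) (secU ss)) \<in> H"
    "pr (cj (rsec s) (secU ss)) (iv (secV ss) \<circ> lsec s \<circ> secV ss) \<in> H"
proof -
  have "cj s (word ss) \<in> {pr (iv (secV ss) \<circ> lsec s \<circ> secV ss) (cj (rsec s) (secU ss)),
     pr (cj (rsec s) (secU ss)) (iv (secV ss) \<circ> lsec s \<circ> secV ss)}"
    using conj_word_pr[of "lsec s" "ev (rsec s)" ss] by (simp add: cj_def flip: ev_pr)
  then show "pr (iv (secV ss) \<circ> lsec s \<circ> secV ss) (cj (rsec s) (secU ss)) \<in> H"
    "pr (cj (rsec s) (secU ss)) (iv (secV ss) \<circ> lsec s \<circ> secV ss) \<in> H"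
    using assms(3) subgroup_pr_swap[OF H] by auto
qed

section \<open>Normal forms and lengths\<close>

definition V4 :: "(bool list \<Rightarrow> bool list) set" where
  "V4 = {id, grig_b, grig_c, grig_d}"

text \<open>Products of elements of \<open>V4 = {1, b, c, d}\<close> and at most \<open>n\<close> factors \<open>a\<close>.\<close>

fun few_a :: "nat \<Rightarrow> (bool list \<Rightarrow> bool list) set" where
  "few_a 0 = V4"
| "few_a (Suc n) = few_a n \<union> {l \<circ> grig_a \<circ> g | l g. l \<in> V4 \<and> g \<in> few_a n}"

lemma ev_V4 [simp]: "ev s \<in> V4" by (cases s) (auto simp: V4_def)
lemma id_V4 [simp]: "id \<in> V4" by (auto simp: V4_def)

lemma V4_cases: "l \<in> V4 \<Longrightarrow> l = id \<or> (\<exists>s. l = ev s)"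
  unfolding V4_def by (metis insertE empty_iff ev.simps)

lemma V4_Gr [simp]: "l \<in> V4 \<Longrightarrow> l \<in> Gr"
  using V4_cases by fastforce

lemma V4_mult [simp]: "l \<in> V4 \<Longrightarrow> l' \<in> V4 \<Longrightarrow> l \<circ> l' \<in> V4"
  by (auto simp: V4_def)

lemma few_a_mono: "n \<le> m \<Longrightarrow> few_a n \<subseteq> few_a m"
  by (induction m) (auto simp: le_Suc_eq)

lemma few_a_left: "l \<in> V4 \<Longrightarrow> g \<in> few_a n \<Longrightarrow> l \<circ> g \<in> few_a n"
proof (induction n)
  case (Suc n)
  consider "g \<in> few_a n" | l' h where "g = l' \<circ> grig_a \<circ> h" "l' \<in> V4" "h \<in> few_a n"
    using Suc.prems by auto
  then show ?case
  proof cases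
    case 2
    then have "l \<circ> g = (l \<circ> l') \<circ> grig_a \<circ> h" "l \<circ> l' \<in> V4"
      using Suc.prems by (simp_all add: comp_assoc)
    then show ?thesis using 2 by auto
  qed (use Suc in simp)
qed simp

lemma few_a_right: "l \<in> V4 \<Longrightarrow> g \<in> few_a n \<Longrightarrow> g \<circ> l \<in> few_a n"
proof (induction n arbitrary: g)
  case (Suc n)
  consider "g \<in> few_a n" | l' h where "g = l' \<circ> grig_a \<circ> h" "l' \<in> V4" "h \<in> few_a n"
    using Suc.prems by auto
  then show ?case
  proof cases
    case 2
    then have "g \<circ> l = l' \<circ> grig_a \<circ> (h \<circ> l)" "h \<circ> l \<in> few_a n"
      using Suc by (simp_all add: comp_assoc)
    then show ?thesis using 2 by auto
  qed (use Suc in simp)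
qed simp

lemma few_a_SucI: "l \<in> V4 \<Longrightarrow> g \<in> few_a n \<Longrightarrow> l \<circ> grig_a \<circ> g \<in> few_a (Suc n)"
  by auto

lemma few_a_a_left: "g \<in> few_a n \<Longrightarrow> grig_a \<circ> g \<in> few_a (Suc n)"
  using few_a_SucI[OF id_V4, of g n] by (simp del: few_a.simps)

lemma few_a_a_right: "g \<in> few_a n \<Longrightarrow> g \<circ> grig_a \<in> few_a (Suc n)"
proof (induction n arbitrary: g)
  case 0
  then show ?case using few_a_SucI[of g id 0] by (simp del: few_a.simps(2))
next
  case (Suc n)
  consider "g \<in> few_a n" | l' h where "g = l' \<circ> grig_a \<circ> h" "l' \<in> V4" "h \<in> few_a n"
    using Suc.prems by auto
  then show ?case
  proof cases
    case 1
    then show ?thesis using Suc.IH few_a_mono[of "Suc n" "Suc (Suc n)"] by (auto simp del: few_a.simps)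
  next
    case 2
    then have "g \<circ> grig_a = l' \<circ> grig_a \<circ> (h \<circ> grig_a)" "h \<circ> grig_a \<in> few_a (Suc n)"
      using Suc.IH by (simp_all add: comp_assoc del: few_a.simps)
    then show ?thesis using few_a_SucI[OF 2(2)] by (simp del: few_a.simps)
  qed
qed

lemma lsec_cases: "lsec s = id \<or> lsec s = grig_a" by (cases s) auto

lemma few_a_lsec_left: "g \<in> few_a n \<Longrightarrow> lsec s \<circ> g \<in> few_a (Suc n)"
  using lsec_cases[of s] few_a_a_left[of g n] few_a_mono[of n "Suc n"] by auto

lemma few_a_lsec_right: "g \<in> few_a n \<Longrightarrow> g \<circ> lsec s \<in> few_a (Suc n)"
  using lsec_cases[of s] few_a_a_right[of g n] few_a_mono[of n "Suc n"] by auto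

lemma ev_few_a0 [simp]: "ev s \<in> few_a 0" "id \<in> few_a 0" by auto

text \<open>The same up to a final factor \<open>a\<close>, which does not matter for conjugates in a group that contains
  \<open>a\<close>.\<close>

definition few_a_mod :: "nat \<Rightarrow> (bool list \<Rightarrow> bool list) set" where
  "few_a_mod n = {g. g \<in> few_a n \<or> g \<circ> grig_a \<in> few_a n}"

lemma few_a_imp_mod: "g \<in> few_a n \<Longrightarrow> g \<in> few_a_mod n" by (simp add: few_a_mod_def)

lemma few_a_mod_mono: "n \<le> m \<Longrightarrow> few_a_mod n \<subseteq> few_a_mod m"
  using few_a_mono[of n m] by (auto simp: few_a_mod_def)

lemma few_a_mod_left: "l \<in> V4 \<Longrightarrow> g \<in> few_a_mod n \<Longrightarrow> l \<circ> g \<in> few_a_mod n"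
  using few_a_left[of l g n] few_a_left[of l "g \<circ> grig_a" n] by (auto simp: few_a_mod_def comp_assoc)

lemma few_a_mod_lsec_left: "g \<in> few_a_mod n \<Longrightarrow> lsec s \<circ> g \<in> few_a_mod (Suc n)"
  using few_a_lsec_left[of g n s] few_a_lsec_left[of "g \<circ> grig_a" n s]
  by (auto simp: few_a_mod_def comp_assoc simp del: few_a.simps)

lemma few_a_mod_lsec_right: "g \<in> few_a_mod n \<Longrightarrow> g \<circ> lsec s \<in> few_a (Suc n)"
proof -
  assume "g \<in> few_a_mod n"
  then consider "g \<in> few_a n" | "g \<circ> grig_a \<in> few_a n" by (auto simp: few_a_mod_def)
  then show ?thesis
  proof cases
    case 2
    have "g = g \<circ> grig_a \<circ> grig_a" by (simp add: comp_assoc)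
    then show ?thesis
      using lsec_cases[of s] 2 few_a_a_right[OF 2] few_a_mono[of n "Suc n"] by (auto simp del: few_a.simps)
  qed (rule few_a_lsec_right)
qed

text \<open>Cancel \<open>a a\<close> and collect adjacent factors in \<open>V4\<close>.\<close>

lemma few_a_normal_form:
  "g \<in> few_a n \<Longrightarrow> \<exists>l \<in> V4. \<exists>ws. length ws \<le> n \<and> (\<exists>e. g = l \<circ> word ws \<circ> e \<and> (e = id \<or> e = grig_a))"
proof (induction n arbitrary: g)
  case 0
  then have "g = g \<circ> word [] \<circ> id" "g \<in> V4" "length ([] :: letter list) \<le> 0" by auto
  then show ?case by blast
next
  case (Suc n)
  consider "g \<in> few_a n" | l h where "g = l \<circ> grig_a \<circ> h" "l \<in> V4" "h \<in> few_a n"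
    using Suc.prems by auto
  then show ?case
  proof cases
    case 1
    then show ?thesis using Suc.IH le_SucI by blast
  next
    case 2
    obtain l' ws e where l': "l' \<in> V4" "length ws \<le> n" "h = l' \<circ> word ws \<circ> e" "e = id \<or> e = grig_a"
      using Suc.IH[OF 2(3)] by blast
    have "\<exists>k \<in> V4. \<exists>vs e'. length vs \<le> Suc n \<and> grig_a \<circ> h = k \<circ> word vs \<circ> e' \<and> (e' = id \<or> e' = grig_a)"
    proof (cases "l' = id")
      case False
      then obtain s where "l' = ev s" using V4_cases l' by blast
      then have "grig_a \<circ> h = id \<circ> word (s # ws) \<circ> e" "length (s # ws) \<le> Suc n"
        using l' by (simp_all add: comp_assoc)
      then show ?thesis using l'(4) id_V4 by blast
    next
      case True
      show ?thesis
      proof (cases ws)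
        case Nil
        then have "grig_a \<circ> h = id \<circ> word [] \<circ> (grig_a \<circ> e)" "grig_a \<circ> e = id \<or> grig_a \<circ> e = grig_a"
          using l' True Nil by auto
        moreover have "length ([] :: letter list) \<le> Suc n" by simp
        ultimately show ?thesis using id_V4 by blast
      next
        case (Cons s vs)
        then have "grig_a \<circ> h = ev s \<circ> word vs \<circ> e" "length vs \<le> Suc n"
          using l' True by (simp_all add: comp_assoc)
        then show ?thesis using ev_V4 l'(4) by blast
      qed
    qed
    then obtain k vs e' where k: "k \<in> V4" "length vs \<le> Suc n" "grig_a \<circ> h = k \<circ> word vs \<circ> e'"
       "e' = id \<or> e' = grig_a"
      by blast
    have "g = (l \<circ> k) \<circ> word vs \<circ> e'"
      using 2(1) k(3) by (simp add: comp_assoc)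
    then show ?thesis using k(2,4) V4_mult[OF 2(2) k(1)] by blast
  qed
qed

lemma cj_commute_V4: "l \<in> V4 \<Longrightarrow> iv l \<circ> ev s \<circ> l = ev s"
  by (cases s) (auto simp: V4_def comp_assoc)

text \<open>In the normal form \<open>l w e\<close> of \<open>g\<close> the element \<open>l\<close> of \<open>V4\<close> commutes with the letter, and \<open>e\<close> is \<open>1\<close>
  or \<open>a\<close>, an element of \<open>H\<close>.\<close>

lemma cj_normal_form:
  assumes H: "subgroup H grigorchuk_group" "grig_a \<in> H" and g: "g \<in> few_a_mod n" "g \<in> Gr" and cj: "cj s g \<in> H"
  shows "\<exists>ws. length ws \<le> n \<and> cj s (word ws) \<in> H"
proof -
  obtain e where e: "g \<circ> e \<in> few_a n" "e = id \<or> e = grig_a"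
  proof (cases "g \<in> few_a n")
    case True
    then show thesis using that[of id] by simp
  next
    case False
    then show thesis using that[of grig_a] g(1) by (simp add: few_a_mod_def)
  qed
  obtain l ws f where l: "l \<in> V4" "length ws \<le> n" "g \<circ> e = l \<circ> word ws \<circ> f" "f = id \<or> f = grig_a"
    using few_a_normal_form[OF e(1)] by blast
  have inv: "e \<circ> e = id" "f \<circ> f = id" "iv e = e" "iv f = f" "e \<in> Gr" "f \<in> Gr" "e \<in> H" "f \<in> H"
    using e(2) l(4) H(2) subgroup_closed(1)[OF H(1)] by auto
  have ivl: "iv l = l"
    using l(1) by (auto simp: V4_def)
  have "iv l \<circ> (g \<circ> e) \<circ> f = word ws"
    unfolding l(3) using l(1) inv by (simp add: comp_assoc)
  then have "word ws = l \<circ> g \<circ> (e \<circ> f)"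
    by (simp add: ivl comp_assoc)
  then have "cj s (word ws) = iv (e \<circ> f) \<circ> (iv g \<circ> (iv l \<circ> ev s \<circ> l) \<circ> g) \<circ> (e \<circ> f)"
    using l(1) inv g by (simp add: cj_def comp_assoc)
  also have "\<dots> = iv (e \<circ> f) \<circ> cj s g \<circ> (e \<circ> f)"
    unfolding cj_commute_V4[OF l(1)] cj_def ..
  also have "\<dots> \<in> H"
    using cj inv(7,8) subgroup_closed(2,3)[OF H(1)] by simp
  finally show ?thesis using l(2) by blast
qed

lemma every_element_few_a: "g \<in> Gr \<Longrightarrow> \<exists>n. g \<in> few_a n"
proof (induction rule: grig_induct)
  case id
  show ?case by (metis ev_few_a0(2))
next
  case (left s g)
  then obtain n where "g \<in> few_a n" by blast
  then show ?case
    using left.hyps(1) few_a_a_left[of g n] few_a_left[of s g n] by (auto simp: V4_def simp del: few_a.simps)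
qed

lemma iv_secV_few_a: "iv (secV ys) \<in> few_a (length ys div 2)"
proof (induction ys rule: induct_list012)
  case (3 s s' ys)
  have "iv (secV (s # s' # ys)) = iv (secV ys) \<circ> lsec s' \<circ> ev (rsec s)"
    by (simp add: comp_assoc)
  moreover have "iv (secV ys) \<circ> lsec s' \<circ> ev (rsec s) \<in> few_a (Suc (length ys div 2))"
    by (intro few_a_right ev_V4 few_a_lsec_right 3)
  ultimately show ?case by (simp del: few_a.simps)
qed auto

text \<open>For words of lengths \<open>m\<close> and \<open>n\<close> this bounds by \<open>(m + n) div 2\<close> the length of the word that
  relates a section of one to a section of the other: every other letter of each word contributes a
  factor \<open>a\<close>. Both words are taken off in steps of two letters. When the lengths have different
  parity, two factors of the same kind meet in the middle and merge, which is why the bound is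
  rounded down.\<close>

lemma mixed_sections: "secU zs \<circ> iv (secV ys) \<in> few_a_mod ((length zs + length ys) div 2)"
proof (induction zs rule: induct_list012)
  case 1
  show ?case using iv_secV_few_a by (simp add: few_a_imp_mod)
next
  case (2 s)
  show ?case
  proof (induction ys rule: induct_list012)
    case 1
    show ?case using lsec_cases[of s] by (auto simp: few_a_mod_def)
  next
    case (2 s')
    have "lsec s \<circ> ev (rsec s') \<in> few_a (Suc 0)" by (intro few_a_lsec_left ev_few_a0)
    then show ?case by (simp add: few_a_imp_mod del: few_a.simps)
  next
    case (3 s' s'' ys)
    have "secU [s] \<circ> iv (secV (s' # s'' # ys)) = secU [s] \<circ> iv (secV ys) \<circ> lsec s'' \<circ> ev (rsec s')"
      by (simp add: comp_assoc)
    moreover have "secU [s] \<circ> iv (secV ys) \<circ> lsec s'' \<circ> ev (rsec s') \<in> few_a (Suc ((length [s] + length ys) div 2))"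
      by (intro few_a_right ev_V4 few_a_mod_lsec_right 3)
    ultimately show ?case by (simp add: few_a_imp_mod del: few_a.simps secU.simps)
  qed
next
  case (3 s s' zs)
  have "secU (s # s' # zs) \<circ> iv (secV ys) = lsec s \<circ> (ev (rsec s') \<circ> (secU zs \<circ> iv (secV ys)))"
    by (simp add: comp_assoc)
  moreover have "lsec s \<circ> (ev (rsec s') \<circ> (secU zs \<circ> iv (secV ys))) \<in> few_a_mod (Suc ((length zs + length ys) div 2))"
    by (intro few_a_mod_lsec_left few_a_mod_left ev_V4 3)
  ultimately show ?case by (simp del: few_a.simps)
qed

text \<open>The letter \<open>d\<close> has trivial first section, so it contributes no factor \<open>a\<close>.\<close>

lemma mixed_sections_D: "secU (D # zs) \<circ> iv (secV ys) \<in> few_a_mod ((length zs + length ys) div 2)"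
proof (cases zs)
  case Nil
  then show ?thesis using iv_secV_few_a by (simp add: few_a_imp_mod)
next
  case (Cons s zs')
  have "secU (D # zs) \<circ> iv (secV ys) = ev (rsec s) \<circ> (secU zs' \<circ> iv (secV ys))"
    by (simp add: Cons comp_assoc)
  also have "\<dots> \<in> few_a_mod ((length zs' + length ys) div 2)"
    by (intro few_a_mod_left ev_V4 mixed_sections)
  also have "\<dots> \<subseteq> few_a_mod ((length zs + length ys) div 2)"
    by (intro few_a_mod_mono) (simp add: Cons div_le_mono)
  finally show ?thesis .
qed

text \<open>Both sections of the same word: each letter contributes one first section, hence at most one factor
  \<open>a\<close>, and none if the letter is \<open>d\<close>.\<close>

lemma equal_sections:
  "secU ys \<circ> iv (secV ys) \<in> few_a (length ys)"
  "D \<in> set ys \<Longrightarrow> secU ys \<circ> iv (secV ys) \<in> few_a (length ys - 1)"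
proof (induction ys rule: induct_list012)
  case (2 s)
  { case 1
    have "lsec s \<circ> ev (rsec s) \<in> few_a (Suc 0)" by (intro few_a_lsec_left ev_few_a0)
    then show ?case by (simp del: few_a.simps)
  next
    case 2
    then show ?case using ev_V4[of B] by auto }
next
  case (3 s s' ys)
  let ?g = "secU ys \<circ> iv (secV ys)"
  have eq: "secU (s # s' # ys) \<circ> iv (secV (s # s' # ys)) = lsec s \<circ> (ev (rsec s') \<circ> (?g \<circ> lsec s' \<circ> ev (rsec s)))"
    by (simp add: comp_assoc)
  { case 1
    have "lsec s \<circ> (ev (rsec s') \<circ> (?g \<circ> lsec s' \<circ> ev (rsec s))) \<in> few_a (Suc (Suc (length ys)))"
      by (intro few_a_lsec_left few_a_left few_a_right few_a_lsec_right ev_V4 3)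
    then show ?case by (simp add: eq del: few_a.simps secU.simps secV.simps)
  next
    case 2
    consider "s = D" | "s' = D" | "D \<in> set ys" "length ys = Suc (length ys - 1)"
      using 2 by (cases ys) auto
    then have "lsec s \<circ> (ev (rsec s') \<circ> (?g \<circ> lsec s' \<circ> ev (rsec s))) \<in> few_a (Suc (length ys))"
    proof cases
      case 1
      have "ev (rsec s') \<circ> (?g \<circ> lsec s' \<circ> ev (rsec s)) \<in> few_a (Suc (length ys))"
        by (intro few_a_left few_a_right few_a_lsec_right ev_V4 3)
      then show ?thesis by (simp add: 1 del: few_a.simps)
    next
      case 2
      have "lsec s \<circ> (ev (rsec s') \<circ> (?g \<circ> ev (rsec s))) \<in> few_a (Suc (length ys))"
        by (intro few_a_lsec_left few_a_left few_a_right ev_V4 3)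
      then show ?thesis by (simp add: 2 del: few_a.simps)
    next
      case c: 3
      have "lsec s \<circ> (ev (rsec s') \<circ> (?g \<circ> lsec s' \<circ> ev (rsec s))) \<in> few_a (Suc (Suc (length ys - 1)))"
        by (intro few_a_lsec_left few_a_left few_a_right few_a_lsec_right ev_V4 3 c)
      then show ?thesis unfolding c(2)[symmetric] .
    qed
    then show ?case by (simp add: eq del: few_a.simps secU.simps secV.simps) }
qed auto

text \<open>The letters of \<open>secU ys (secV ys)\<^sup>-\<^sup>1\<close> when no factor \<open>a\<close> is lost: numbering them from 1, those with even index in increasing
  order, then those with odd index in decreasing order, each replaced by its second section.\<close>

fun fold_letters :: "letter list \<Rightarrow> letter list" where
  "fold_letters [] = []"
| "fold_letters [s] = [rsec s]"
| "fold_letters (s # s' # ss) = rsec s' # fold_letters ss @ [rsec s]"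

lemma word_append: "word (xs @ ys) = word xs \<circ> word ys"
  by (induction xs) (simp_all add: comp_assoc)

lemma lsec_not_D: "s \<noteq> D \<Longrightarrow> lsec s = grig_a"
  by (cases s) auto

lemma equal_sections_word: "D \<notin> set ys \<Longrightarrow> secU ys \<circ> iv (secV ys) = word (fold_letters ys)"
proof (induction ys rule: induct_list012)
  case (2 s)
  then show ?case using lsec_not_D by simp
next
  case (3 s s' ys)
  have a: "lsec s = grig_a" "lsec s' = grig_a"
    using 3(3) lsec_not_D by auto
  have "secU (s # s' # ys) \<circ> iv (secV (s # s' # ys)) =
    lsec s \<circ> ev (rsec s') \<circ> (secU ys \<circ> iv (secV ys)) \<circ> lsec s' \<circ> ev (rsec s)"
    by (simp add: comp_assoc)
  also have "secU ys \<circ> iv (secV ys) = word (fold_letters ys)"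
    using 3 by simp
  finally show ?case by (simp add: a word_append comp_assoc)
qed auto

lemma set_fold_letters [simp]: "set (fold_letters ys) = rsec ` set ys"
  by (induction ys rule: fold_letters.induct) auto

lemma length_fold_letters [simp]: "length (fold_letters ys) = length ys"
  by (induction ys rule: fold_letters.induct) auto

section \<open>Generation by three conjugates\<close>

lemma cj_Gr: "g \<in> Gr \<Longrightarrow> cj s g \<in> Gr" by (simp add: cj_def)

lemma sections_conj_subgroup:
  assumes H: "subgroup H grigorchuk_group" and v: "v \<in> Gr"
  shows "subgroup {x \<in> Gr. iv v \<circ> x \<circ> v \<in> sections H} grigorchuk_group"
proof -
  note cl = subgroup_closed[OF H]
  have sub: "id \<in> sections H" "\<And>x y. x \<in> sections H \<Longrightarrow> y \<in> sections H \<Longrightarrow> x \<circ> y \<in> sections H"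
    "\<And>x. x \<in> sections H \<Longrightarrow> iv x \<in> sections H"
  proof -
    have "pr id id \<in> H" by (simp add: cl(1))
    then show "id \<in> sections H" unfolding sections_def by blast
    show "x \<circ> y \<in> sections H" if "x \<in> sections H" "y \<in> sections H" for x y
      using that cl(2)[of "pr x _" "pr y _"] unfolding sections_def by (auto simp: pr_comp)
    show "iv x \<in> sections H" if x: "x \<in> sections H" for x
    proof -
      obtain y where y: "pr x y \<in> H" using x by (auto simp: sections_def)
      then have "iv (pr x y) \<in> H" by (rule cl(3))
      then show ?thesis using cl(4)[OF y] by (auto simp: sections_def)
    qed
  qed
  show ?thesis
  proof (rule subgroup.intro)
    show "x \<otimes>\<^bsub>grigorchuk_group\<^esub> y \<in> {x \<in> Gr. iv v \<circ> x \<circ> v \<in> sections H}"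
      if "x \<in> {x \<in> Gr. iv v \<circ> x \<circ> v \<in> sections H}" "y \<in> {x \<in> Gr. iv v \<circ> x \<circ> v \<in> sections H}" for x y
      using that v sub(2)[of "iv v \<circ> x \<circ> v" "iv v \<circ> y \<circ> v"] by (simp add: comp_assoc)
    show "iv x \<in> {x \<in> Gr. iv v \<circ> x \<circ> v \<in> sections H}"
      if "x \<in> {x \<in> Gr. iv v \<circ> x \<circ> v \<in> sections H}" for x
      using that v sub(3)[of "iv v \<circ> x \<circ> v"] by (simp add: comp_assoc)
  qed (use v sub(1) in auto)
qed

lemma normal_closure_full:
  assumes M: "M \<lhd> grigorchuk_group" and a: "grig_a \<in> M" and "cj s g \<in> M" "cj r h \<in> M" "s \<noteq> r"
    "g \<in> Gr" "h \<in> Gr"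
  shows "M = Gr"
proof -
  note cl = subgroup_closed[OF normal_imp_subgroup[OF M]]
  have "ev s \<in> M" if "cj s g \<in> M" "g \<in> Gr" for s g
    using normal_conj(1)[OF M that] that by (simp add: cj_def comp_assoc)
  then have "ev s \<in> M" "ev r \<in> M" using assms by auto
  then have "ev s \<in> M" "ev r \<in> M" "ev s \<circ> ev r \<in> M" using cl(2) by auto
  then have "{grig_a, grig_b, grig_c, grig_d} \<subseteq> M"
    using a \<open>s \<noteq> r\<close> by (cases s; cases r) auto
  then show ?thesis
    using grig.subgroup_eq_if_contains_generators[OF _ generate_grig normal_imp_subgroup[OF M]] by auto
qed

text \<open>All conjugates of \<open>d\<close> fix the second level of the tree, \<open>c\<close> does not.\<close>

lemma c_not_conj_d:
  assumes "g \<in> Gr" "h \<in> Gr"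
  shows "cj C g \<noteq> cj D h"
proof
  assume eq: "cj C g = cj D h"
  note N = level_stab_normal[of 2]
  have "grig_d w = w" if "length w = 2" for w
    using that by (cases w rule: grig_d.cases) (auto simp: length_Suc_conv numeral_2_eq_2 split: bool.splits,
       metis (full_types) grig_b.simps grig_a.simps(1) grig_c.simps(1))
  then have "grig_d \<in> level_stab 2" by (simp add: level_stab_def)
  then have "cj C g \<in> level_stab 2"
    unfolding eq using normal_conj(2)[OF N _ assms(2)] by (simp add: cj_def)
  then have "g \<circ> cj C g \<circ> iv g \<in> level_stab 2"
    using normal_conj(1)[OF N _ assms(1)] by simp
  then have "grig_c \<in> level_stab 2"
    using assms by (simp add: cj_def comp_assoc)
  then have "length [False, False] = 2 \<longrightarrow> grig_c [False, False] = [False, False]"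
    unfolding level_stab_def by blast
  then show False by simp
qed

text \<open>A nontrivial element \<open>pr e 1\<close> of \<open>H\<close> has to be found. A conjugate of \<open>d = pr 1 b\<close> is of this form up
  to exchange of the coordinates. If instead \<open>H\<close> contains conjugates of \<open>b\<close> and \<open>c\<close>, their first
  sections are both conjugate to \<open>a\<close>. As the sections of \<open>H\<close> are full, the first one can be
  conjugated within \<open>H\<close> so that these sections agree; they cancel in the product, whose second section
  is a product of conjugates of \<open>c\<close> and \<open>d\<close>.\<close>

lemma subgroup_eq_if_sections_eq:
  assumes H: "subgroup H grigorchuk_group" and a: "grig_a \<in> H"
    and s: "cj s (word ys) \<in> H" and r: "cj r (word zs) \<in> H" and neq: "s \<noteq> r"
    and sec: "sections H = Gr"
  shows "H = Gr"
proof -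
  note cl = subgroup_closed[OF H]
  have "\<exists>e. pr e id \<in> H \<and> e \<noteq> id"
  proof (cases "s = D \<or> r = D")
    case True
    then obtain ws where "cj D (word ws) \<in> H" using s r by auto
    from cj_word_pr(2)[OF H a this] have "pr (cj B (secU ws)) id \<in> H" by simp
    moreover have "cj B (secU ws) \<noteq> id"
    proof
      assume "cj B (secU ws) = id"
      then have "secU ws \<circ> cj B (secU ws) \<circ> iv (secU ws) = id" by simp
      then have "grig_b = id" by (simp add: cj_def comp_assoc)
      then have "grig_b [False, False] = [False, False]" by (simp add: id_apply)
      then show False by simp
    qed
    ultimately show ?thesis by blast
  next
    case False
    then obtain us vs where us: "cj B (word us) \<in> H" and vs: "cj C (word vs) \<in> H"
      using s r neq by (cases s; cases r) auto
    define p p' q q' where defs: "p = secV us" "p' = secV vs" "q = secU us" "q' = secU vs"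
    have G: "p \<in> Gr" "p' \<in> Gr" "q \<in> Gr" "q' \<in> Gr" by (simp_all add: defs)
    have 1: "pr (iv p \<circ> grig_a \<circ> p) (cj C q) \<in> H" and 2: "pr (iv p' \<circ> grig_a \<circ> p') (cj D q') \<in> H"
      using cj_word_pr(1)[OF H a us] cj_word_pr(1)[OF H a vs] by (simp_all add: defs)
    have "iv p \<circ> p' \<in> sections H" unfolding sec using G by simp
    then obtain y where y: "pr (iv p \<circ> p') y \<in> H" by (auto simp: sections_def)
    have yG: "y \<in> Gr" using pr_Gr_D(2)[OF cl(4)[OF y]] .
    have "iv (pr (iv p \<circ> p') y) \<circ> pr (iv p \<circ> grig_a \<circ> p) (cj C q) \<circ> pr (iv p \<circ> p') y \<circ>
        pr (iv p' \<circ> grig_a \<circ> p') (cj D q') \<in> H"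
      using 1 2 y cl(2,3) by (simp del: pr_comp iv_pr)
    then have "pr id (cj C (q \<circ> y) \<circ> cj D q') \<in> H"
      using cl(4)[OF y] G yG by (simp add: cj_def comp_assoc)
    then have "pr (cj C (q \<circ> y) \<circ> cj D q') id \<in> H" by (rule subgroup_pr_swap[OF H a])
    moreover have "cj C (q \<circ> y) \<circ> cj D q' \<noteq> id"
    proof
      assume "cj C (q \<circ> y) \<circ> cj D q' = id"
      then have "cj C (q \<circ> y) \<circ> cj D q' \<circ> cj D q' = cj D q'" by simp
      then have "cj C (q \<circ> y) = cj D q'" using G yG by (simp add: cj_def comp_assoc)
      then show False using c_not_conj_d G yG by simp
    qed
    ultimately show ?thesis by blast
  qed
  then show ?thesis
    using subgroup_eq_if_sections_full[OF H a _ sec] normal_closure_full[of _ s "word ys" r "word zs"]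
      s r neq a by (metis word_Gr subsetD)
qed

text \<open>One passage to sections. The letter \<open>s\<close> has first section \<open>a\<close>, and \<open>H'\<close> is the group of first
  sections of \<open>H\<close>, conjugated so that the conjugate of \<open>a\<close> that comes from \<open>s\<close> becomes \<open>a\<close> itself.\<close>

lemma section_step:
  assumes H: "subgroup H grigorchuk_group" and a: "grig_a \<in> H"
    and s: "cj s (word ys) \<in> H" and r: "cj r (word zs) \<in> H" and neq: "s \<noteq> r" and base: "s \<noteq> D"
  obtains H' where "subgroup H' grigorchuk_group" "grig_a \<in> H'"
    "cj (rsec s) (secU ys \<circ> iv (secV ys)) \<in> H'" "cj (rsec r) (secU zs \<circ> iv (secV ys)) \<in> H'"
    "H' = Gr \<Longrightarrow> H = Gr"
proof -
  define v where "v = secV ys"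
  have v: "v \<in> Gr" by (simp add: v_def)
  let ?H' = "{x \<in> Gr. iv v \<circ> x \<circ> v \<in> sections H}"
  have in_sec: "iv v \<circ> grig_a \<circ> v \<in> sections H" "cj (rsec s) (secU ys) \<in> sections H" "cj (rsec r) (secU zs) \<in> sections H"
    using cj_word_pr[OF H a s] cj_word_pr[OF H a r] lsec_not_D[OF base]
    unfolding sections_def v_def by auto
  have *: "iv v \<circ> cj t (u \<circ> iv v) \<circ> v = cj t u" if "u \<in> Gr" for t u
    using v that by (simp add: cj_def comp_assoc)
  have "H = Gr" if full: "?H' = Gr"
  proof (rule subgroup_eq_if_sections_eq[OF H a s r neq])
    have "x \<in> sections H" if x: "x \<in> Gr" for x
    proof -
      have "v \<circ> x \<circ> iv v \<in> ?H'" unfolding full using v x by simp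
      then show ?thesis using v x by (simp add: comp_assoc)
    qed
    moreover have "sections H \<subseteq> Gr"
      using subgroup_closed(4)[OF H] pr_Gr_D(1) unfolding sections_def by blast
    ultimately show "sections H = Gr" by blast
  qed
  then show thesis
    using that[OF sections_conj_subgroup[OF H v]] in_sec * v by (simp add: cj_Gr flip: v_def)
qed

definition conj_generate :: "letter \<Rightarrow> nat \<Rightarrow> letter \<Rightarrow> nat \<Rightarrow> bool" where
  "conj_generate s m r n \<longleftrightarrow> (\<forall>H ys zs. subgroup H grigorchuk_group \<longrightarrow> grig_a \<in> H \<longrightarrow>
     length ys \<le> m \<longrightarrow> cj s (word ys) \<in> H \<longrightarrow> length zs \<le> n \<longrightarrow> cj r (word zs) \<in> H \<longrightarrow> H = Gr)"

lemma conj_generate_sym: "conj_generate s m r n \<longleftrightarrow> conj_generate r n s m"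
  unfolding conj_generate_def by blast

lemma conj_generateD:
  assumes "conj_generate s m r n" "subgroup H grigorchuk_group" "grig_a \<in> H"
    "u \<in> few_a_mod m" "u \<in> Gr" "cj s u \<in> H" "v \<in> few_a_mod n" "v \<in> Gr" "cj r v \<in> H"
  shows "H = Gr"
  using assms(1) cj_normal_form[OF assms(2,3,4,5,6)] cj_normal_form[OF assms(2,3,7,8,9)] assms(2,3)
  unfolding conj_generate_def by blast

text \<open>Induction on the bound for the lengths of the two conjugating words. Let the bound be \<open>m + 1\<close>. In one
  step with base letter \<open>s\<close> the new words have at most as many letters as the word of \<open>s\<close> and
  as the mean of the two numbers, respectively.

  If one word has at most \<open>m\<close> letters, then at most two steps make both that short: one step
  if the short word belongs to the base, and one step more if the base is forced to be the other
  letter because the short word belongs to \<open>d\<close>. So it suffices to shorten one word. This happens if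
  the word of the base contains \<open>d\<close> or if the other word begins with \<open>d\<close>.

  Otherwise the new word of the base is the old one with the letters moved along \<open>b, c, d\<close> and
  reordered. From \<open>{b, c}\<close> with base \<open>b\<close> one gets to \<open>{c, d}\<close>, where the base must be \<open>c\<close>, and then
  to \<open>{d, b}\<close>, where it must be \<open>b\<close>. If no word is shortened, the word that belongs to \<open>b\<close> contains
  no \<open>d\<close>, then, belonging to \<open>c\<close>, again no \<open>d\<close>. So it was a power of \<open>a b\<close>, then of
  \<open>a c\<close>, and finally it belongs to \<open>d\<close>, is a power of \<open>a d\<close> and begins with \<open>d\<close>.\<close>

lemma conj_generate_all:
  "s \<noteq> r \<Longrightarrow> conj_generate s n r n"
proof (induction n arbitrary: s r)
  case 0
  show ?case
    unfolding conj_generate_def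
  proof (intro allI impI)
    fix H ys zs
    assume H: "subgroup H grigorchuk_group" "grig_a \<in> H" and "length ys \<le> 0" "cj s (word ys) \<in> H"
      "length zs \<le> 0" "cj r (word zs) \<in> H"
    then have "ev s \<in> H" "ev r \<in> H" by (simp_all add: cj_def)
    then have "ev s \<in> H" "ev r \<in> H" "ev s \<circ> ev r \<in> H" using subgroup_closed(2)[OF H(1)] by auto
    then have "{grig_a, grig_b, grig_c, grig_d} \<subseteq> H"
      using H \<open>s \<noteq> r\<close> by (cases s; cases r) auto
    then show "H = Gr"
      using grig.subgroup_eq_if_contains_generators[OF _ generate_grig H(1)] by auto
  qed
next
  case (Suc m)
  have rsec_neq: "rsec s \<noteq> rsec r" if "s \<noteq> r" for s r using that by (cases s; cases r) auto
  have mix: "u \<in> few_a_mod m" if "u \<in> few_a_mod ((i + j) div 2)" "i \<le> Suc m" "j \<le> m" for u i j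
  proof -
    have "(i + j) div 2 \<le> m" using that(2,3) by linarith
    then show ?thesis using that(1) few_a_mod_mono by blast
  qed
  have mix': "u \<in> few_a_mod (Suc m)" if "u \<in> few_a_mod ((i + j) div 2)" "i \<le> Suc m" "j \<le> Suc m" for u i j
  proof -
    have "(i + j) div 2 \<le> Suc m" using that(2,3) by linarith
    then show ?thesis using that(1) few_a_mod_mono by blast
  qed
  have base_small: "conj_generate s m r (Suc m)" if "s \<noteq> r" "s \<noteq> D" for s r
    unfolding conj_generate_def
  proof (intro allI impI)
    fix H ys zs
    assume H: "subgroup H grigorchuk_group" "grig_a \<in> H" "cj s (word ys) \<in> H" "cj r (word zs) \<in> H"
      and len: "length ys \<le> m" "length zs \<le> Suc m"
    obtain H' where H': "subgroup H' grigorchuk_group" "grig_a \<in> H'"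
      "cj (rsec s) (secU ys \<circ> iv (secV ys)) \<in> H'" "cj (rsec r) (secU zs \<circ> iv (secV ys)) \<in> H'"
      "H' = Gr \<Longrightarrow> H = Gr"
      using section_step[OF H \<open>s \<noteq> r\<close> \<open>s \<noteq> D\<close>] by blast
    have "secU ys \<circ> iv (secV ys) \<in> few_a_mod m"
      using few_a_imp_mod[OF equal_sections(1)] few_a_mod_mono[OF len(1)] by blast
    moreover have "secU zs \<circ> iv (secV ys) \<in> few_a_mod m"
      using mix[OF mixed_sections len(2,1)] .
    ultimately show "H = Gr"
      using H'(5) conj_generateD[OF Suc.IH[OF rsec_neq[OF \<open>s \<noteq> r\<close>]] H'(1,2) _ _ H'(3) _ _ H'(4)] by simp
  qed
  have one_small: "conj_generate s m r (Suc m)" if neq: "s \<noteq> r" for s r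
  proof (cases "s = D")
    case False
    then show ?thesis using base_small neq by blast
  next
    case True
    then have r: "r \<noteq> D" using neq by simp
    have "conj_generate r (Suc m) s m"
      unfolding conj_generate_def
    proof (intro allI impI)
      fix H ys zs
      assume H: "subgroup H grigorchuk_group" "grig_a \<in> H" "cj r (word ys) \<in> H" "cj s (word zs) \<in> H"
        and len: "length ys \<le> Suc m" "length zs \<le> m"
      obtain H' where H': "subgroup H' grigorchuk_group" "grig_a \<in> H'"
        "cj (rsec r) (secU ys \<circ> iv (secV ys)) \<in> H'" "cj (rsec s) (secU zs \<circ> iv (secV ys)) \<in> H'"
        "H' = Gr \<Longrightarrow> H = Gr"
        using section_step[OF H neq[symmetric] r] by blast
      have "secU ys \<circ> iv (secV ys) \<in> few_a_mod (Suc m)"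
        using few_a_imp_mod[OF equal_sections(1)] few_a_mod_mono[OF len(1)] by blast
      moreover have "secU zs \<circ> iv (secV ys) \<in> few_a_mod m"
        using mix[of _ "length ys" "length zs"] mixed_sections[of zs ys] len by (simp add: add.commute)
      moreover have "conj_generate (rsec s) m (rsec r) (Suc m)"
        using base_small[OF rsec_neq[OF neq]] True by simp
      ultimately show "H = Gr"
        using H'(5) conj_generateD[OF _ H'(1,2) _ _ H'(4) _ _ H'(3)] by simp
    qed
    then show ?thesis using conj_generate_sym by blast
  qed
  note small = one_small conj_generate_sym[THEN iffD1, OF one_small]
  have base_D: "H = Gr" if H: "subgroup H grigorchuk_group" "grig_a \<in> H" "cj s (word ys) \<in> H" "cj r (word zs) \<in> H"
      and len: "length ys \<le> Suc m" "length zs \<le> Suc m" and s: "s \<noteq> r" "s \<noteq> D" and D: "D \<in> set ys" for H s r ys zs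
  proof -
    obtain H' where H': "subgroup H' grigorchuk_group" "grig_a \<in> H'"
      "cj (rsec s) (secU ys \<circ> iv (secV ys)) \<in> H'" "cj (rsec r) (secU zs \<circ> iv (secV ys)) \<in> H'"
      "H' = Gr \<Longrightarrow> H = Gr"
      using section_step[OF H s] by blast
    have "length ys - 1 \<le> m" using len by simp
    then have "secU ys \<circ> iv (secV ys) \<in> few_a_mod m"
      using few_a_imp_mod[OF equal_sections(2)[OF D]] few_a_mod_mono by blast
    moreover have "secU zs \<circ> iv (secV ys) \<in> few_a_mod (Suc m)"
      using mix'[OF mixed_sections len(2,1)] .
    ultimately show ?thesis
      using H'(5) conj_generateD[OF one_small[OF rsec_neq[OF s(1)]] H'(1,2) _ _ H'(3) _ _ H'(4)] by simp
  qed
  have other_D: "H = Gr" if H: "subgroup H grigorchuk_group" "grig_a \<in> H" "cj s (word ys) \<in> H" "cj r (word (D # zs)) \<in> H"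
      and len: "length ys \<le> Suc m" "length zs \<le> m" and s: "s \<noteq> r" "s \<noteq> D" for H s r ys zs
  proof -
    obtain H' where H': "subgroup H' grigorchuk_group" "grig_a \<in> H'"
      "cj (rsec s) (secU ys \<circ> iv (secV ys)) \<in> H'" "cj (rsec r) (secU (D # zs) \<circ> iv (secV ys)) \<in> H'"
      "H' = Gr \<Longrightarrow> H = Gr"
      using section_step[OF H s] by blast
    have "secU ys \<circ> iv (secV ys) \<in> few_a_mod (Suc m)"
      using few_a_imp_mod[OF equal_sections(1)] few_a_mod_mono[OF len(1)] by blast
    moreover have "secU (D # zs) \<circ> iv (secV ys) \<in> few_a_mod m"
      using mix[of _ "length ys" "length zs"] mixed_sections_D[of zs ys] len by (simp add: add.commute)
    ultimately show ?thesis
      using H'(5) conj_generateD[OF small(2)[OF rsec_neq[OF s(1), symmetric]] H'(1,2) _ _ H'(3) _ _ H'(4)] by simp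
  qed
  \<comment> \<open>A step in which the word of the base contains no letter d.\<close>
  have no_D: "H = Gr" if H: "subgroup H grigorchuk_group" "grig_a \<in> H" "cj s (word ys) \<in> H" "cj r (word zs) \<in> H"
      and len: "length ys \<le> Suc m" "length zs \<le> Suc m" and s: "s \<noteq> r" "s \<noteq> D" and D: "D \<notin> set ys"
      and cont: "\<And>H' vs. subgroup H' grigorchuk_group \<Longrightarrow> grig_a \<in> H' \<Longrightarrow> length vs \<le> Suc m \<Longrightarrow>
         cj (rsec s) (word (fold_letters ys)) \<in> H' \<Longrightarrow> cj (rsec r) (word vs) \<in> H' \<Longrightarrow> H' = Gr" for H s r ys zs
  proof -
    obtain H' where H': "subgroup H' grigorchuk_group" "grig_a \<in> H'"
      "cj (rsec s) (secU ys \<circ> iv (secV ys)) \<in> H'" "cj (rsec r) (secU zs \<circ> iv (secV ys)) \<in> H'"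
      "H' = Gr \<Longrightarrow> H = Gr"
      using section_step[OF H s] by blast
    have "secU zs \<circ> iv (secV ys) \<in> few_a_mod (Suc m)"
      using mix'[OF mixed_sections len(2,1)] .
    then obtain vs where "length vs \<le> Suc m" "cj (rsec r) (word vs) \<in> H'"
      using cj_normal_form[OF H'(1,2) _ _ H'(4)] by auto
    then show ?thesis
      using cont[OF H'(1,2)] H'(3,5) equal_sections_word[OF D] by simp
  qed
  \<comment> \<open>The last case: the next step finds a word of letters d only.\<close>
  have CD_C: "H = Gr" if H: "subgroup H grigorchuk_group" "grig_a \<in> H" "cj C (word ys) \<in> H" "cj D (word zs) \<in> H"
      and len: "length ys \<le> Suc m" "length zs \<le> Suc m" and C: "set ys \<subseteq> {C}" for H ys zs
  proof (cases ys)
    case Nil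
    then show ?thesis
      using small(1)[of C D] H len unfolding conj_generate_def by (metis le0 letter.distinct(5) list.size(3))
  next
    case (Cons x xs)
    have "set (fold_letters ys) \<subseteq> {D}" "fold_letters ys \<noteq> []"
      using C Cons length_fold_letters[of ys] by (auto simp del: length_fold_letters)
    then obtain us where us: "fold_letters ys = D # us" "length us \<le> m"
      using length_fold_letters[of ys] len by (cases "fold_letters ys") auto
    show ?thesis
    proof (rule no_D[OF H len])
      fix H' vs
      assume H': "subgroup H' grigorchuk_group" "grig_a \<in> H'" "length vs \<le> Suc m"
         "cj (rsec C) (word (fold_letters ys)) \<in> H'" "cj (rsec D) (word vs) \<in> H'"
      then show "H' = Gr"
        using other_D[of H' B vs D us] us by simp
    qed (use C in auto)
  qed
  have BC: "H = Gr" if H: "subgroup H grigorchuk_group" "grig_a \<in> H" "cj B (word ys) \<in> H" "cj C (word zs) \<in> H"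
      and len: "length ys \<le> Suc m" "length zs \<le> Suc m" for H ys zs
  proof (cases "D \<in> set ys")
    case True
    then show ?thesis using base_D[OF H len] by simp
  next
    case False
    show ?thesis
    proof (rule no_D[OF H len _ _ False])
      fix H' vs
      assume H': "subgroup H' grigorchuk_group" "grig_a \<in> H'" "length vs \<le> Suc m"
         "cj (rsec B) (word (fold_letters ys)) \<in> H'" "cj (rsec C) (word vs) \<in> H'"
      have "set (fold_letters ys) \<subseteq> {C}" if "C \<notin> set ys"
      proof
        fix x assume "x \<in> set (fold_letters ys)"
        then obtain y where y: "y \<in> set ys" "x = rsec y" by auto
        then have "y \<noteq> C" "y \<noteq> D" using that False by metis+
        then show "x \<in> {C}" using y(2) by (cases y) auto
      qed
      note 1 = this
      have 2: "D \<in> set (fold_letters ys)" if "C \<in> set ys"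
        using imageI[OF that, of rsec] by simp
      have H'': "cj C (word (fold_letters ys)) \<in> H'" "cj D (word vs) \<in> H'" "length (fold_letters ys) \<le> Suc m"
        using H' len by simp_all
      show "H' = Gr"
      proof (cases "C \<in> set ys")
        case True
        show ?thesis
          by (rule base_D[OF H'(1,2) H''(1,2,3) H'(3) _ _ 2[OF True]]) simp_all
      next
        case False
        show ?thesis
          by (rule CD_C[OF H'(1,2) H''(1,2,3) H'(3) 1[OF False]])
      qed
    qed auto
  qed
  have BD: "H = Gr" if H: "subgroup H grigorchuk_group" "grig_a \<in> H" "cj B (word ys) \<in> H" "cj D (word zs) \<in> H"
      and len: "length ys \<le> Suc m" "length zs \<le> Suc m" for H ys zs
  proof (cases "D \<in> set ys")
    case True
    then show ?thesis using base_D[OF H len] by simp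
  next
    case False
    show ?thesis
      by (rule no_D[OF H len _ _ False]) (use BC len in auto)
  qed
  have CD: "H = Gr" if H: "subgroup H grigorchuk_group" "grig_a \<in> H" "cj C (word ys) \<in> H" "cj D (word zs) \<in> H"
      and len: "length ys \<le> Suc m" "length zs \<le> Suc m" for H ys zs
  proof (cases "D \<in> set ys")
    case True
    then show ?thesis using base_D[OF H len] by simp
  next
    case False
    show ?thesis
      by (rule no_D[OF H len _ _ False]) (use BD len in auto)
  qed
  show ?case
    using BC BD CD Suc.prems unfolding conj_generate_def by (cases s; cases r) blast+
qed

text \<open>Conjugating by \<open>x\<close> reduces to the case that \<open>a\<close> itself belongs to the group.\<close>

theorem conjugates_generate:
  assumes "x \<in> Gr" "y \<in> Gr" "z \<in> Gr"
  shows "generate grigorchuk_group {iv x \<circ> grig_a \<circ> x, iv y \<circ> grig_b \<circ> y, iv z \<circ> grig_c \<circ> z} = Gr"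
    (is "?H = Gr")
proof -
  have sub: "subgroup ?H grigorchuk_group"
    using assms by (intro grig.generate_is_subgroup) auto
  note cl = subgroup_closed[OF sub]
  have gens: "iv x \<circ> grig_a \<circ> x \<in> ?H" "iv y \<circ> grig_b \<circ> y \<in> ?H" "iv z \<circ> grig_c \<circ> z \<in> ?H"
    by (simp_all add: generate.incl)
  define H where "H = {h \<in> Gr. iv x \<circ> h \<circ> x \<in> ?H}"
  have H: "subgroup H grigorchuk_group"
  proof (rule subgroup.intro)
    show "g \<otimes>\<^bsub>grigorchuk_group\<^esub> h \<in> H" if "g \<in> H" "h \<in> H" for g h
      using that assms cl(2)[of "iv x \<circ> g \<circ> x" "iv x \<circ> h \<circ> x"] by (simp add: H_def comp_assoc)
    show "iv g \<in> H" if "g \<in> H" for g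
      using that assms cl(3)[of "iv x \<circ> g \<circ> x"] by (simp add: H_def comp_assoc)
  qed (use assms cl(1) in \<open>auto simp: H_def\<close>)
  have a: "grig_a \<in> H"
    using gens(1) by (simp add: H_def)
  have conj: "cj s (g \<circ> iv x) \<in> H" if "iv g \<circ> ev s \<circ> g \<in> ?H" "g \<in> Gr" for s g
    using that assms by (simp add: H_def cj_def comp_assoc)
  have b: "cj B (y \<circ> iv x) \<in> H" and c: "cj C (z \<circ> iv x) \<in> H"
    using assms gens by (simp_all add: conj)
  obtain m n where mn: "y \<circ> iv x \<in> few_a m" "z \<circ> iv x \<in> few_a n"
    using every_element_few_a[of "y \<circ> iv x"] every_element_few_a[of "z \<circ> iv x"] assms by auto
  have "y \<circ> iv x \<in> few_a_mod (max m n)" "z \<circ> iv x \<in> few_a_mod (max m n)"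
    using few_a_imp_mod[OF mn(1)] few_a_imp_mod[OF mn(2)] few_a_mod_mono[of m "max m n"] few_a_mod_mono[of n "max m n"] by auto
  then have "H = Gr"
    using conj_generateD[OF conj_generate_all[of B C "max m n"] H a _ _ b _ _ c] assms by auto
  have "g \<in> ?H" if g: "g \<in> Gr" for g
  proof -
    have "x \<circ> g \<circ> iv x \<in> H" unfolding \<open>H = Gr\<close> using g assms by simp
    then show ?thesis using g assms by (simp add: H_def comp_assoc)
  qed
  then show ?thesis using cl(4) by blast
qed

section \<open>The minimal number of invariable generators\<close>

lemma invariably_generates_abc: "invariably_generates grigorchuk_group {grig_a, grig_b, grig_c}"
  using conjugates_generate
  by (auto simp: invariably_generates_def conj_by_def)

text \<open>The parity of the number of vertices on level \<open>n\<close> at which \<open>f\<close> swaps the two subtrees.\<close>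

fun parity :: "nat \<Rightarrow> (bool list \<Rightarrow> bool list) \<Rightarrow> bool" where
  "parity 0 f = (f [False] = [True])"
| "parity (Suc n) f = (parity n (\<lambda>w. tl (f (False # w))) \<noteq> parity n (\<lambda>w. tl (f (True # w))))"

lemma parity_pr [simp]:
  "pr x y \<in> Gr \<Longrightarrow> parity 0 (pr x y) = False" "parity (Suc n) (pr x y) = (parity n x \<noteq> parity n y)"
  "x \<in> Gr \<Longrightarrow> y \<in> Gr \<Longrightarrow> parity 0 (pr x y \<circ> grig_a) = True"
  "parity (Suc n) (pr x y \<circ> grig_a) = (parity n y \<noteq> parity n x)"
  by (auto simp: Gr_Nil comp_def)

lemma parity_id: "parity n id = False"
proof (induction n)
  case (Suc n)
  have "parity (Suc n) (pr id id) = (parity n id \<noteq> parity n id)" by (rule parity_pr(2))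
  then show ?case by simp
qed (simp add: id_apply)

lemma parity_comp: "f \<in> Gr \<Longrightarrow> g \<in> Gr \<Longrightarrow> parity n (f \<circ> g) = (parity n f \<noteq> parity n g)"
proof (induction n arbitrary: f g)
  case 0
  have *: "h [False] = [True] \<or> h [False] = [False]" "h [True] = [True] \<or> h [True] = [False]"
    "h [False] \<noteq> h [True]" if "h \<in> Gr" for h
    using that by (cases rule: grig_cases; simp add: Gr_Nil comp_apply)+
  show ?case using *[OF 0(1)] *[OF 0(2)] by (auto simp: comp_apply)
next
  case (Suc n)
  from Suc.prems(1) show ?case
  proof (cases rule: grig_cases)
    case f: (stab x y)
    from Suc.prems(2) show ?thesis
    proof (cases rule: grig_cases)
      case (stab x' y')
      show ?thesis using f stab Suc.IH by (auto simp del: parity.simps)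
    next
      case (swap x' y')
      show ?thesis using f swap Suc.IH by (auto simp del: parity.simps)
    qed
  next
    case f: (swap x y)
    from Suc.prems(2) show ?thesis
    proof (cases rule: grig_cases)
      case (stab x' y')
      show ?thesis using f stab Suc.IH by (auto simp: comp_assoc simp del: parity.simps)
    next
      case (swap x' y')
      show ?thesis using f swap Suc.IH by (auto simp: comp_assoc simp del: parity.simps)
    qed
  qed
qed

lemma parity_gens:
  "parity 0 grig_a" "\<not> parity 1 grig_a" "\<not> parity 2 grig_a"
  "\<not> parity 0 grig_c" "parity 1 grig_c" "\<not> parity 2 grig_c"
  "\<not> parity 0 grig_d" "\<not> parity 1 grig_d" "parity 2 grig_d"
  by (simp_all add: numeral_2_eq_2)

lemma two_bool_vectors_annihilated:
  obtains p q r where "p \<or> q \<or> r" "((p \<and> u0) \<noteq> ((q \<and> u1) \<noteq> (r \<and> u2))) = False"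
    "((p \<and> v0) \<noteq> ((q \<and> v1) \<noteq> (r \<and> v2))) = False"
proof -
  have "\<exists>p q r. (p \<or> q \<or> r) \<and> ((p \<and> u0) \<noteq> ((q \<and> u1) \<noteq> (r \<and> u2))) = False
     \<and> ((p \<and> v0) \<noteq> ((q \<and> v1) \<noteq> (r \<and> v2))) = False"
    by (cases u0; cases u1; cases u2; cases v0; cases v1; cases v2; simp add: ex_bool_eq)
  then show thesis by (elim exE conjE) (rule that)
qed

text \<open>The parities on the levels 0, 1, 2 map \<open>a\<close>, \<open>c\<close>, \<open>d\<close> to a basis of a three-dimensional space over
  the field with two elements. Some nonzero linear functional vanishes on the images of any two
  elements, and therefore on the group that they generate.\<close>

lemma card_invariably_generating:
  assumes S: "finite S" "invariably_generates grigorchuk_group S"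
  shows "3 \<le> card S"
proof (rule ccontr)
  assume "\<not> 3 \<le> card S"
  have sub: "S \<subseteq> Gr" using S by (simp add: invariably_generates_def)
  \<comment> \<open>With trivial conjugators, an invariable generating set generates.\<close>
  have "conj_by grigorchuk_group s id = s" if "s \<in> S" for s
    using that sub by (auto simp: conj_by_def)
  then have "(\<lambda>s. conj_by grigorchuk_group s id) ` S = S" by simp
  moreover have "generate grigorchuk_group ((\<lambda>s. conj_by grigorchuk_group s id) ` S) = Gr"
    using S(2) by (simp add: invariably_generates_def)
  ultimately have gen: "generate grigorchuk_group S = Gr" by simp
  obtain u v where uv: "S \<subseteq> {u, v}"
  proof -
    consider "card S = 0" | "card S = 1" | "card S = 2" using \<open>\<not> 3 \<le> card S\<close> by linarith
    then show thesis
    proof cases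
      case 1
      then show thesis using that S(1) by auto
    next
      case 2
      then show thesis using that by (metis card_1_singletonE subset_insertI)
    next
      case 3
      then show thesis using that by (metis card_2_iff subset_refl)
    qed
  qed
  obtain p q r where pqr: "p \<or> q \<or> r"
    and u0: "((p \<and> parity 0 u) \<noteq> ((q \<and> parity 1 u) \<noteq> (r \<and> parity 2 u))) = False"
    and v0: "((p \<and> parity 0 v) \<noteq> ((q \<and> parity 1 v) \<noteq> (r \<and> parity 2 v))) = False"
    by (rule two_bool_vectors_annihilated)
  define l where "l g \<longleftrightarrow> ((p \<and> parity 0 g) \<noteq> ((q \<and> parity 1 g) \<noteq> (r \<and> parity 2 g)))" for g
  have l: "\<not> l id" "\<And>f g. f \<in> Gr \<Longrightarrow> g \<in> Gr \<Longrightarrow> l (f \<circ> g) \<longleftrightarrow> l f \<noteq> l g"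
    by (auto simp: l_def parity_id parity_comp simp del: parity.simps)
  have l_iv: "l (iv f) = l f" if "f \<in> Gr" for f
    using l(1) l(2)[of f "iv f"] that by auto
  have "subgroup {g \<in> Gr. \<not> l g} grigorchuk_group"
    using l l_iv by unfold_locales auto
  moreover have "S \<subseteq> {g \<in> Gr. \<not> l g}"
  proof
    fix s assume "s \<in> S"
    then have "s \<in> Gr" "s = u \<or> s = v" using uv sub by auto
    moreover have "\<not> l u" "\<not> l v" unfolding l_def using u0 v0 by blast+
    ultimately show "s \<in> {g \<in> Gr. \<not> l g}" by blast
  qed
  ultimately have "{g \<in> Gr. \<not> l g} = Gr"
    using grig.subgroup_eq_if_contains_generators[OF sub gen] by blast
  then have "\<not> l grig_a" "\<not> l grig_c" "\<not> l grig_d" using gens_Gr by blast+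
  then show False
    using pqr parity_gens by (auto simp: l_def simp del: parity.simps)
qed

lemma gens_distinct: "card {grig_a, grig_b, grig_c} = 3"
proof -
  have "grig_a [False] \<noteq> grig_b [False]" "grig_a [False] \<noteq> grig_c [False]"
    "grig_b [True, False, False] \<noteq> grig_c [True, False, False]" by simp_all
  then have "grig_a \<noteq> grig_b" "grig_a \<noteq> grig_c" "grig_b \<noteq> grig_c" by metis+
  then show ?thesis by simp
qed

lemma FIG_grig: "FIG grigorchuk_group"
  unfolding FIG_def
  by (rule exI[of _ "{grig_a, grig_b, grig_c}"]) (simp add: invariably_generates_abc)

lemma d_I_grig: "d_I grigorchuk_group = 3"
  unfolding d_I_def
proof (rule Least_equality)
  show "\<exists>S. finite S \<and> card S = 3 \<and> invariably_generates grigorchuk_group S"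
    by (rule exI[of _ "{grig_a, grig_b, grig_c}"])
       (intro conjI invariably_generates_abc gens_distinct, simp)
  show "3 \<le> n" if n: "\<exists>S. finite S \<and> card S = n \<and> invariably_generates grigorchuk_group S" for n
  proof -
    obtain S where S: "finite S" "card S = n" "invariably_generates grigorchuk_group S"
      using n by (elim exE conjE)
    show ?thesis using card_invariably_generating[OF S(1,3)] unfolding S(2) .
  qed
qed

section \<open>Residual finiteness\<close>

lemma level_stab_finite_index: "finite_index grigorchuk_group (level_stab n)"
proof (rule grig.finite_index_if_finite_image)
  let ?L = "{w :: bool list. length w = n}"
  show "subgroup (level_stab n) grigorchuk_group"
    by (intro normal_imp_subgroup level_stab_normal)
  have sub: "(\<lambda>g. restrict g ?L) ` Gr \<subseteq> ?L \<rightarrow>\<^sub>E ?L"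
    by (intro image_subsetI PiE_I) auto
  have "finite ?L" using finite_lists_length_eq[of "UNIV :: bool set" n] by simp
  then show "finite ((\<lambda>g. restrict g ?L) ` Gr)"
    by (intro finite_subset[OF sub] finite_PiE)
  show "g \<otimes>\<^bsub>grigorchuk_group\<^esub> iv h \<in> level_stab n"
    if "g \<in> Gr" "h \<in> Gr" "restrict g ?L = restrict h ?L" for g h
  proof -
    have "g (iv h w) = w" if w: "length w = n" for w
    proof -
      have "g (iv h w) = h (iv h w)"
        using fun_cong[OF \<open>restrict g ?L = restrict h ?L\<close>, of "iv h w"] w \<open>h \<in> Gr\<close> by simp
      also have "\<dots> = w" using iv_cancel(2)[OF \<open>h \<in> Gr\<close>] by (metis comp_apply id_apply)
      finally show ?thesis .
    qed
    then show ?thesis using that(1,2) by (simp add: level_stab_def comp_apply)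
  qed
qed

lemma residually_finite_grig: "residually_finite grigorchuk_group"
  unfolding residually_finite_def
proof (intro ballI impI)
  fix x assume "x \<in> Gr" "x \<noteq> \<one>\<^bsub>grigorchuk_group\<^esub>"
  then obtain v where "x v \<noteq> v" by (auto simp: fun_eq_iff id_apply)
  then have "x \<notin> level_stab (length v)" by (auto simp: level_stab_def)
  then show "\<exists>N. N \<lhd> grigorchuk_group \<and> finite_index grigorchuk_group N \<and> x \<notin> N"
    using level_stab_normal level_stab_finite_index by blast
qed

section \<open>No solvable subgroup of finite index\<close>

lemma ac_nontrivial: "grig_a \<circ> grig_c \<noteq> id"
proof
  assume "grig_a \<circ> grig_c = id"
  from fun_cong[OF this, of "[False]"] show False by (simp add: comp_apply id_apply)
qed

lemma K_nonabelian: "pr grig_t id \<circ> grig_t \<noteq> grig_t \<circ> pr grig_t id"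
proof
  assume "pr grig_t id \<circ> grig_t = grig_t \<circ> pr grig_t id"
  then have "grig_t \<circ> (grig_c \<circ> grig_a) = (grig_c \<circ> grig_a) \<circ> grig_t"
    unfolding t_pr by simp
  then have "pr (grig_c \<circ> grig_a) (grig_a \<circ> grig_c) \<circ> (pr grig_a grig_d \<circ> grig_a)
      = (pr grig_a grig_d \<circ> grig_a) \<circ> pr (grig_c \<circ> grig_a) (grig_a \<circ> grig_c)"
    unfolding t_pr[symmetric] bcd_pr(2)[symmetric] .
  then have "grig_a \<circ> grig_b = grig_b \<circ> grig_a"
    by (simp add: comp_assoc)
  then have "grig_t = grig_a \<circ> (grig_a \<circ> grig_b) \<circ> grig_b"
    unfolding grig_t_def by (simp add: comp_assoc)
  then have "grig_t = id" by (simp add: comp_assoc)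
  then show False using ac_nontrivial unfolding t_pr by simp
qed

text \<open>The injection of \<open>K\<close> into itself by \<open>k \<mapsto> pr k 1\<close> misses \<open>t\<close>.\<close>

lemma infinite_Gr: "infinite Gr"
proof
  assume "finite Gr"
  then have fin: "finite grig_K" using K_closed(4) by (meson finite_subset subsetI)
  have "(\<lambda>k. pr k id) ` grig_K \<subseteq> grig_K" using K_pairs(1) by blast
  moreover have "inj_on (\<lambda>k. pr k id) grig_K" by (simp add: inj_on_def)
  ultimately have "(\<lambda>k. pr k id) ` grig_K = grig_K" by (rule endo_inj_surj[OF fin])
  then obtain k where "grig_t = pr k id" using t_K by blast
  then show False using ac_nontrivial by (simp add: t_pr)
qed

text \<open>As long as \<open>f\<close> fixes the subtrees on the way to \<open>v\<close>, pass to a section. When it exchanges them,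
  \<open>[pr k 1, f]\<close> has first section \<open>k\<close>, and \<open>K\<close> is not abelian.\<close>

lemma commutators_noncommuting:
  assumes "f \<in> Gr" "f v \<noteq> v"
  shows "\<exists>k \<in> grig_K. \<exists>k' \<in> grig_K. comm k f \<circ> comm k' f \<noteq> comm k' f \<circ> comm k f"
  using assms
proof (induction v arbitrary: f)
  case Nil
  then show ?case using Gr_Nil by simp
next
  case (Cons x v)
  from Cons.prems(1) show ?case
  proof (cases rule: grig_cases)
    case (stab f0 f1)
    have G: "pr f0 f1 \<in> Gr" using Cons.prems(1) stab(3) by simp
    have "f0 v \<noteq> v \<or> f1 v \<noteq> v"
      using Cons.prems(2) stab by (cases x) auto
    then show ?thesis
    proof
      assume "f0 v \<noteq> v"
      then obtain k k' where k: "k \<in> grig_K" "k' \<in> grig_K" "comm k f0 \<circ> comm k' f0 \<noteq> comm k' f0 \<circ> comm k f0"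
        using Cons.IH[OF stab(1)] by blast
      have "comm (pr k id) f \<circ> comm (pr k' id) f \<noteq> comm (pr k' id) f \<circ> comm (pr k id) f"
        unfolding stab(3) comm_corner_stab(1)[OF k(1) G] comm_corner_stab(1)[OF k(2) G] using k(3) by simp
      then show ?thesis using K_pairs(1) k by blast
    next
      assume "f1 v \<noteq> v"
      then obtain k k' where k: "k \<in> grig_K" "k' \<in> grig_K" "comm k f1 \<circ> comm k' f1 \<noteq> comm k' f1 \<circ> comm k f1"
        using Cons.IH[OF stab(2)] by blast
      have "comm (pr id k) f \<circ> comm (pr id k') f \<noteq> comm (pr id k') f \<circ> comm (pr id k) f"
        unfolding stab(3) comm_corner_stab(2)[OF k(1) G] comm_corner_stab(2)[OF k(2) G] using k(3) by simp
      then show ?thesis using K_pairs(2) k by blast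
    qed
  next
    case (swap u w)
    have G: "pr u w \<in> Gr" using Cons.prems(1) unfolding swap(3) by (rule pr_comp_a_Gr[THEN iffD1])
    note k = K_pairs(1)[OF t_K] t_K
    have "comm (pr (pr grig_t id) id) f \<circ> comm (pr grig_t id) f \<noteq> comm (pr grig_t id) f \<circ> comm (pr (pr grig_t id) id) f"
      unfolding swap(3) comm_corner_swap[OF k(1) G] comm_corner_swap[OF k(2) G] using K_nonabelian by simp
    then show ?thesis using K_pairs(1) k by blast
  qed
qed

lemma normal_nonabelian:
  assumes A: "A \<lhd> grigorchuk_group" "A \<noteq> {id}"
  shows "\<exists>x \<in> A. \<exists>y \<in> A. x \<circ> y \<noteq> y \<circ> x"
proof -
  note cl = subgroup_closed[OF normal_imp_subgroup[OF A(1)]]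
  obtain f where f: "f \<in> A" "f \<noteq> id" using A(2) cl(1) by blast
  then obtain v where v: "f v \<noteq> v" by (auto simp: fun_eq_iff id_apply)
  have "comm k f \<in> A" if "k \<in> grig_K" for k
    using grig.commutator_swap[OF A(1) cl(4)[OF f(1)] K_closed(4)[OF that]]
      grig.commutator_in_normal[OF A(1) f(1) K_closed(4)[OF that]] by simp
  then show ?thesis using commutators_noncommuting[OF cl(4)[OF f(1)] v] by blast
qed

lemma not_virtually_solvable_grig: "\<not> virtually_solvable grigorchuk_group"
proof
  assume "virtually_solvable grigorchuk_group"
  then obtain H where H: "subgroup H grigorchuk_group" "finite_index grigorchuk_group H"
    "solvable (grigorchuk_group\<lparr>carrier := H\<rparr>)"
    by (auto simp: virtually_solvable_def)
  obtain N where N: "N \<lhd> grigorchuk_group" "N \<subseteq> H" "N \<noteq> {\<one>\<^bsub>grigorchuk_group\<^esub>}"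
    using grig.finite_index_normal_core[OF infinite_Gr H(1,2)] by blast
  obtain A where A: "A \<lhd> grigorchuk_group" "A \<noteq> {\<one>\<^bsub>grigorchuk_group\<^esub>}"
    "\<And>x y. x \<in> A \<Longrightarrow> y \<in> A \<Longrightarrow> x \<otimes>\<^bsub>grigorchuk_group\<^esub> y = y \<otimes>\<^bsub>grigorchuk_group\<^esub> x"
    using grig.solvable_normal_contains_abelian[OF H(1,3) N] by blast
  have "x \<circ> y = y \<circ> x" if "x \<in> A" "y \<in> A" for x y
    using A(3)[OF that] that subgroup_closed(4)[OF normal_imp_subgroup[OF A(1)]] by simp
  then show False using normal_nonabelian[OF A(1)] A(2) by auto
qed

theorem corollary2p7:
  shows "FIG grigorchuk_group \<and> d_I grigorchuk_group = 3
    \<and> residually_finite grigorchuk_group \<and> \<not> virtually_solvable grigorchuk_group"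
  using FIG_grig d_I_grig residually_finite_grig not_virtually_solvable_grig by blast

end
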